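(* Let $X\neq\{0\}$ be a Banach space, let $t_0<t_1$ be real numbers, let $0<\alpha<\beta\le 1$ and let $n\in\mathbb{N}$. Then $$H^{n,\beta}([t_0,t_1];X)\subsetneq C^{n+\alpha}([t_0,t_1];X),$$ and the inclusion is continuous, i.e. there is $M>0$ with $\|f\|_{C^{n+\alpha}([t_0,t_1];X)}\le M\|f\|_{H^{n,\beta}([t_0,t_1];X)}$ for all $f\in H^{n,\beta}([t_0,t_1];X)$.
   Context: $\mathbb{N}=\{0,1,2,\ldots\}$. $[\gamma]$ denotes the smallest integer greater than or equal to $\gamma$. For $\gamma>0$, $J_{t_0,t}^{\gamma}f(t)=\frac{1}{\Gamma(\gamma)}\int_{t_0}^{t}(t-s)^{\gamma-1}f(s)\,ds$ (Bochner integral), $J_{t_0,t}^0f=f$. The Riemann–Liouville fractional derivative is $D_{t_0,t}^{\gamma}f(t)=\frac{d^{[\gamma]}}{dt^{[\gamma]}}\big[J_{t_0,t}^{[\gamma]-\gamma}f(t)\big]$ in the weak sense, and the Caputo fractional derivative is $cD_{t_0,t}^{\gamma}f(t)=D_{t_0,t}^{\gamma}\Big[f(t)-\sum_{j=0}^{[\gamma]-1}\frac{f^{(j)}(t_0)}{j!}(t-t_0)^j\Big]$. For an integer $k\ge0$, $C^k([t_0,t_1];X)$ is the usual space with norm $\sum_{j=0}^k\sup_t\|f^{(j)}(t)\|_X$. For $\gamma>0$, $C^{\gamma}([t_0,t_1];X)=\{f\in C^{[\gamma]-1}([t_0,t_1];X): cD_{t_0,t}^{\gamma}f\in C^0([t_0,t_1];X)\}$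 (the weak derivative exists and has a continuous representative), with norm $\|f\|_{C^{\gamma}}=\|f\|_{C^{[\gamma]-1}}+\|cD_{t_0,t}^{\gamma}f\|_{C^0}$. This is NOT the Hölder space. For $n\in\mathbb{N}$ and $\beta\in(0,1]$, $H^{n,\beta}([t_0,t_1];X)$ is the space of $n$-times continuously differentiable $f:[t_0,t_1]\to X$ such that $\|f^{(n)}(t)-f^{(n)}(s)\|_X\le M|t-s|^{\beta}$ for all $t,s$ and some $M>0$, with norm $\|f\|_{C^n}+\sup_{t\neq s}\frac{\|f^{(n)}(t)-f^{(n)}(s)\|_X}{|t-s|^{\beta}}$. *)

theory Defs
  imports "HOL-Analysis.Analysis"
begin

text \<open>
  The library's Bochner integral is restricted to second countable (that is, separable) spaces.
  The following is the library's definition with that class constraint dropped, so that arbitrary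
  Banach spaces are covered. It is used with complete measures only: there, a Borel measurable
  function approximated in this way is strongly measurable, and conversely, also if the space
  is not separable.
\<close>

definition has_banach_integral :: "'m measure \<Rightarrow> ('m \<Rightarrow> 'a::banach) \<Rightarrow> 'a \<Rightarrow> bool" where
  "has_banach_integral M f x \<longleftrightarrow>
     f \<in> borel_measurable M \<and>
     (\<exists>s. (\<forall>i. Bochner_Integration.simple_bochner_integrable M (s i)) \<and>
          (\<lambda>i. \<integral>\<^sup>+ y. ennreal (norm (f y - s i y)) \<partial>M) \<longlonglongrightarrow> 0 \<and>
          (\<lambda>i::nat. Bochner_Integration.simple_bochner_integral M (s i)) \<longlonglongrightarrow> x)"

definition banach_integrable :: "'m measure \<Rightarrow> ('m \<Rightarrow> 'a::banach) \<Rightarrow> bool" where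
  "banach_integrable M f \<longleftrightarrow> (\<exists>x. has_banach_integral M f x)"

definition banach_integral :: "'m measure \<Rightarrow> ('m \<Rightarrow> 'a::banach) \<Rightarrow> 'a" where
  "banach_integral M f = (if banach_integrable M f then THE x. has_banach_integral M f x else 0)"

lemma has_banach_integral_iff_has_bochner_integral:
  fixes f :: "'m \<Rightarrow> 'a::{banach, second_countable_topology}"
  shows "has_banach_integral M f x \<longleftrightarrow> has_bochner_integral M f x"
  unfolding has_banach_integral_def has_bochner_integral.simps by blast

lemma banach_integral_eq_lebesgue_integral:
  fixes f :: "'m \<Rightarrow> 'a::{banach, second_countable_topology}"
  shows "banach_integral M f = integral\<^sup>L M f"
  unfolding banach_integral_def banach_integrable_def lebesgue_integral_def
    has_banach_integral_iff_has_bochner_integral ..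

text \<open>
  A function on \<open>[a, b]\<close> is represented by a total function of which only the values on
  \<^term>\<open>{a..b}\<close> matter; derivatives are one-sided at the end points.
\<close>

definition ivl_deriv :: "real \<Rightarrow> real \<Rightarrow> nat \<Rightarrow> (real \<Rightarrow> 'a::banach) \<Rightarrow> real \<Rightarrow> 'a" where
  "ivl_deriv a b k f = ((\<lambda>g t. vector_derivative g (at t within {a..b})) ^^ k) f"

definition Ck :: "real \<Rightarrow> real \<Rightarrow> nat \<Rightarrow> (real \<Rightarrow> 'a::banach) set" where
  "Ck a b k = {f. (\<forall>j<k. ivl_deriv a b j f differentiable_on {a..b}) \<and>
                  (\<forall>j\<le>k. continuous_on {a..b} (ivl_deriv a b j f))}"

definition sup_norm :: "real \<Rightarrow> real \<Rightarrow> (real \<Rightarrow> 'a::banach) \<Rightarrow> real" where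
  "sup_norm a b f = (SUP t\<in>{a..b}. norm (f t))"

definition Ck_norm :: "real \<Rightarrow> real \<Rightarrow> nat \<Rightarrow> (real \<Rightarrow> 'a::banach) \<Rightarrow> real" where
  "Ck_norm a b k f = (\<Sum>j\<le>k. sup_norm a b (ivl_deriv a b j f))"

definition holder_space :: "real \<Rightarrow> real \<Rightarrow> nat \<Rightarrow> real \<Rightarrow> (real \<Rightarrow> 'a::banach) set" where
  "holder_space a b n \<beta> =
     {f \<in> Ck a b n. \<exists>M>0. \<forall>t\<in>{a..b}. \<forall>s\<in>{a..b}.
        norm (ivl_deriv a b n f t - ivl_deriv a b n f s) \<le> M * \<bar>t - s\<bar> powr \<beta>}"

definition holder_norm :: "real \<Rightarrow> real \<Rightarrow> nat \<Rightarrow> real \<Rightarrow> (real \<Rightarrow> 'a::banach) \<Rightarrow> real" where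
  "holder_norm a b n \<beta> f =
     Ck_norm a b n f +
     (SUP (t, s)\<in>{(t, s). t \<in> {a..b} \<and> s \<in> {a..b} \<and> t \<noteq> s}.
        norm (ivl_deriv a b n f t - ivl_deriv a b n f s) / \<bar>t - s\<bar> powr \<beta>)"

definition rl_integral :: "real \<Rightarrow> real \<Rightarrow> (real \<Rightarrow> 'a::banach) \<Rightarrow> real \<Rightarrow> 'a" where
  "rl_integral a \<gamma> f t =
     (if \<gamma> = 0 then f t
      else (1 / Gamma \<gamma>) *\<^sub>R
             banach_integral (lebesgue_on {a..t}) (\<lambda>s. (t - s) powr (\<gamma> - 1) *\<^sub>R f s))"

definition test_function :: "real \<Rightarrow> real \<Rightarrow> (real \<Rightarrow> real) \<Rightarrow> bool" where
  "test_function a b \<phi> \<longleftrightarrow>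
     (\<forall>k x. (deriv ^^ k) \<phi> field_differentiable at x) \<and>
     closure {x. \<phi> x \<noteq> 0} \<subseteq> {a<..<b}"

definition locally_integrable :: "real \<Rightarrow> real \<Rightarrow> (real \<Rightarrow> 'a::banach) \<Rightarrow> bool" where
  "locally_integrable a b u \<longleftrightarrow>
     (\<forall>c d. a < c \<and> d < b \<longrightarrow> banach_integrable (lebesgue_on {c..d}) u)"

definition has_weak_deriv ::
  "real \<Rightarrow> real \<Rightarrow> nat \<Rightarrow> (real \<Rightarrow> 'a::banach) \<Rightarrow> (real \<Rightarrow> 'a) \<Rightarrow> bool" where
  "has_weak_deriv a b m u w \<longleftrightarrow>
     locally_integrable a b u \<and> locally_integrable a b w \<and>
     (\<forall>\<phi>. test_function a b \<phi> \<longrightarrow>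
        banach_integral (lebesgue_on {a<..<b}) (\<lambda>t. (deriv ^^ m) \<phi> t *\<^sub>R u t) =
        (- 1) ^ m *\<^sub>R banach_integral (lebesgue_on {a<..<b}) (\<lambda>t. \<phi> t *\<^sub>R w t))"

definition has_rl_deriv ::
  "real \<Rightarrow> real \<Rightarrow> real \<Rightarrow> (real \<Rightarrow> 'a::banach) \<Rightarrow> (real \<Rightarrow> 'a) \<Rightarrow> bool" where
  "has_rl_deriv a b \<gamma> f w \<longleftrightarrow>
     has_weak_deriv a b (nat \<lceil>\<gamma>\<rceil>) (rl_integral a (of_int \<lceil>\<gamma>\<rceil> - \<gamma>) f) w"

definition has_caputo_deriv ::
  "real \<Rightarrow> real \<Rightarrow> real \<Rightarrow> (real \<Rightarrow> 'a::banach) \<Rightarrow> (real \<Rightarrow> 'a) \<Rightarrow> bool" where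
  "has_caputo_deriv a b \<gamma> f w \<longleftrightarrow>
     has_rl_deriv a b \<gamma>
       (\<lambda>t. f t - (\<Sum>j<nat \<lceil>\<gamma>\<rceil>. ((t - a) ^ j / fact j) *\<^sub>R ivl_deriv a b j f a)) w"

text \<open>
  The space \<open>C\<^sup>\<gamma>([a, b]; X)\<close> for \<open>\<gamma> > 0\<close>. The Caputo derivative is a weak derivative, hence
  determined almost everywhere only; the norm uses its continuous representative, which is
  unique on \<^term>\<open>{a..b}\<close>.
\<close>

definition caputo_space :: "real \<Rightarrow> real \<Rightarrow> real \<Rightarrow> (real \<Rightarrow> 'a::banach) set" where
  "caputo_space a b \<gamma> =
     {f \<in> Ck a b (nat \<lceil>\<gamma>\<rceil> - 1). \<exists>w. continuous_on {a..b} w \<and> has_caputo_deriv a b \<gamma> f w}"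

definition caputo_deriv :: "real \<Rightarrow> real \<Rightarrow> real \<Rightarrow> (real \<Rightarrow> 'a::banach) \<Rightarrow> real \<Rightarrow> 'a" where
  "caputo_deriv a b \<gamma> f = (SOME w. continuous_on {a..b} w \<and> has_caputo_deriv a b \<gamma> f w)"

definition caputo_norm :: "real \<Rightarrow> real \<Rightarrow> real \<Rightarrow> (real \<Rightarrow> 'a::banach) \<Rightarrow> real" where
  "caputo_norm a b \<gamma> f =
     Ck_norm a b (nat \<lceil>\<gamma>\<rceil> - 1) f + sup_norm a b (caputo_deriv a b \<gamma> f)"

end

theory Submission
  imports Defs
begin

text \<open>
  Let \<open>G\<close> be \<open>f\<close> minus its Taylor polynomial of degree \<open>n\<close> at \<open>a\<close>, and let \<open>h\<close> be the \<open>n\<close>-th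
  derivative of \<open>G\<close>. The singular kernel \<open>x\<^bsup>-\<alpha>\<^esup>\<close> of the fractional integral of order \<open>1 - \<alpha>\<close> is
  approximated by kernels \<open>k\<^sub>\<delta>\<close> that are continuously differentiable and vanish for \<open>x \<le> 0\<close>. The
  derivative of order \<open>n + 1\<close> of \<open>k\<^sub>\<delta> * G\<close> is \<open>k\<^sub>\<delta>' * h\<close>, which is uniformly Cauchy as \<open>\<delta> \<rightarrow> 0\<close> and
  bounded by the Hoelder seminorm of \<open>h\<close>. Weak derivatives survive uniform limits, so the limit
  is the Caputo derivative of \<open>f\<close>, up to the factor \<open>1 / \<Gamma>(1 - \<alpha>)\<close>.

  As the space need not be separable, Bochner integrals are turned into Henstock-Kurzweil
  integrals, whose library theory covers arbitrary Banach spaces.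
\<close>

text \<open>Differentiating the fractional integral of order \<open>1 - \<alpha>\<close> under the
  integral sign would produce the kernel \<open>x powr (- \<alpha> - 1)\<close>, which is not
  integrable at 0. The Hoelder condition repairs this: once \<open>h t\<close> is subtracted, the
  integrand has size \<open>x powr (\<beta> - \<alpha> - 1)\<close>, which is integrable because
  \<alpha> < \<beta>. With regularised kernels every differentiation is classical, and only this
  estimate has to survive the limit. Of the \<open>n + 1\<close> derivatives, \<open>n\<close> are
  moved onto \<open>G\<close>, whose derivatives up to order \<open>n\<close> vanish at
  \<open>a\<close> and so leave no boundary terms; only the last one falls on the kernel.
  Convergence costs a part of the gap: a factor \<open>\<delta> powr \<theta>\<close> is paid for
  with \<open>x powr - \<theta>\<close>, and \<theta> = (\<beta> - \<alpha>) / 2 keeps the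
  singularity integrable. The norm of the Caputo space uses an arbitrarily chosen continuous
  representative, so uniqueness of continuous weak derivatives is needed before the bound on the
  constructed one bounds the norm.\<close>

section \<open>Bochner integrals in arbitrary Banach spaces\<close>

text \<open>Riemann sums of \<open>f - s i\<close> are bounded in norm by those of \<open>norm (f - s i)\<close>, which is why
  convergence in mean suffices for the Henstock-Kurzweil integral.\<close>

lemma has_integral_L1_limit:
  fixes f :: "'n::euclidean_space \<Rightarrow> 'a::real_normed_vector"
  assumes s: "\<And>i::nat. (s i has_integral x i) (cbox a b)"
    and d: "\<And>i. ((\<lambda>y. norm (f y - s i y)) has_integral e i) (cbox a b)"
    and e: "e \<longlonglongrightarrow> 0" and x: "x \<longlonglongrightarrow> X"
  shows "(f has_integral X) (cbox a b)"
  unfolding has_integral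
proof safe
  fix \<epsilon> :: real assume \<epsilon>: "\<epsilon> > 0"
  have "\<forall>\<^sub>F i in sequentially. dist (e i) 0 < \<epsilon>/4 \<and> dist (x i) X < \<epsilon>/4"
    by (intro eventually_conj tendstoD e x) (use \<epsilon> in auto)
  then obtain i where i: "dist (e i) 0 < \<epsilon>/4" "dist (x i) X < \<epsilon>/4"
    using eventually_happens by fastforce
  obtain \<gamma>1 where \<gamma>1: "gauge \<gamma>1" "\<And>\<D>. \<D> tagged_division_of (cbox a b) \<Longrightarrow> \<gamma>1 fine \<D> \<Longrightarrow>
      norm ((\<Sum>(x, k)\<in>\<D>. measure lborel k *\<^sub>R s i x) - x i) < \<epsilon>/4"
    using s[of i, unfolded has_integral, rule_format, of "\<epsilon>/4"] \<epsilon> by auto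
  obtain \<gamma>2 where \<gamma>2: "gauge \<gamma>2" "\<And>\<D>. \<D> tagged_division_of (cbox a b) \<Longrightarrow> \<gamma>2 fine \<D> \<Longrightarrow>
      norm ((\<Sum>(x, k)\<in>\<D>. measure lborel k *\<^sub>R norm (f x - s i x)) - e i) < \<epsilon>/4"
    using d[of i, unfolded has_integral, rule_format, of "\<epsilon>/4"] \<epsilon> by auto
  show "\<exists>\<gamma>. gauge \<gamma> \<and> (\<forall>\<D>. \<D> tagged_division_of cbox a b \<and> \<gamma> fine \<D> \<longrightarrow>
          norm ((\<Sum>(x, k)\<in>\<D>. measure lborel k *\<^sub>R f x) - X) < \<epsilon>)"
  proof (intro exI conjI allI impI)
    show "gauge (\<lambda>x. \<gamma>1 x \<inter> \<gamma>2 x)" using \<gamma>1(1) \<gamma>2(1) by (rule gauge_Int)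
    fix \<D> assume D: "\<D> tagged_division_of cbox a b \<and> (\<lambda>x. \<gamma>1 x \<inter> \<gamma>2 x) fine \<D>"
    have 1: "norm ((\<Sum>(x, k)\<in>\<D>. measure lborel k *\<^sub>R s i x) - x i) < \<epsilon>/4"
      using D by (intro \<gamma>1) (auto simp: fine_Int)
    have 2: "norm ((\<Sum>(x, k)\<in>\<D>. measure lborel k *\<^sub>R norm (f x - s i x)) - e i) < \<epsilon>/4"
      using D by (intro \<gamma>2) (auto simp: fine_Int)
    have "norm ((\<Sum>(x, k)\<in>\<D>. measure lborel k *\<^sub>R f x) - (\<Sum>(x, k)\<in>\<D>. measure lborel k *\<^sub>R s i x))
        \<le> (\<Sum>(x, k)\<in>\<D>. measure lborel k *\<^sub>R norm (f x - s i x))"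
      unfolding sum_subtractf[symmetric]
    proof (rule order_trans[OF norm_sum], rule sum_mono)
      fix p assume "p \<in> \<D>"
      obtain x k where p: "p = (x, k)" by fastforce
      have "measure lborel k *\<^sub>R f x - measure lborel k *\<^sub>R s i x = measure lborel k *\<^sub>R (f x - s i x)"
        by (rule scaleR_diff_right[symmetric])
      then show "norm ((case p of (x, k) \<Rightarrow> measure lborel k *\<^sub>R f x) - (case p of (x, k) \<Rightarrow> measure lborel k *\<^sub>R s i x))
          \<le> (case p of (x, k) \<Rightarrow> measure lborel k *\<^sub>R norm (f x - s i x))"
        unfolding p by simp
    qed
    then have "norm ((\<Sum>(x, k)\<in>\<D>. measure lborel k *\<^sub>R f x) - (\<Sum>(x, k)\<in>\<D>. measure lborel k *\<^sub>R s i x)) < \<epsilon>/2"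
      using 2 i(1) unfolding dist_norm real_norm_def by linarith
    moreover have "norm (x i - X) < \<epsilon>/4" using i(2) by (simp add: dist_norm)
    ultimately have "norm (((\<Sum>(x, k)\<in>\<D>. measure lborel k *\<^sub>R f x) - (\<Sum>(x, k)\<in>\<D>. measure lborel k *\<^sub>R s i x))
        + ((\<Sum>(x, k)\<in>\<D>. measure lborel k *\<^sub>R s i x) - x i) + (x i - X)) < \<epsilon>/2 + \<epsilon>/4 + \<epsilon>/4"
      using 1 by (intro le_less_trans[OF norm_triangle_ineq] add_strict_mono)
    then show "norm ((\<Sum>(x, k)\<in>\<D>. measure lborel k *\<^sub>R f x) - X) < \<epsilon>" by simp
  qed
qed

lemma simple_bochner_integrable_has_integral:
  fixes s :: "'n::euclidean_space \<Rightarrow> 'a::real_normed_vector"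
  assumes S: "S \<in> sets lebesgue"
    and s: "Bochner_Integration.simple_bochner_integrable (lebesgue_on S) s"
  shows "(s has_integral Bochner_Integration.simple_bochner_integral (lebesgue_on S) s) S"
proof -
  let ?M = "lebesgue_on S"
  from s have sf: "simple_function ?M s" and fin: "emeasure ?M {y\<in>space ?M. s y \<noteq> 0} \<noteq> \<infinity>"
    by (auto elim: Bochner_Integration.simple_bochner_integrable.cases)
  have F: "finite (s ` S)" using sf by (simp add: simple_function_def)
  have "((\<lambda>x. \<Sum>y\<in>s`S. indicator {x\<in>S. s x = y} x *\<^sub>R y) has_integral
      (\<Sum>y\<in>s`S. measure ?M {x\<in>S. s x = y} *\<^sub>R y)) S"
  proof (rule has_integral_sum[OF F])
    fix y assume y: "y \<in> s ` S"
    show "((\<lambda>x. indicator {x\<in>S. s x = y} x *\<^sub>R y) has_integral measure ?M {x\<in>S. s x = y} *\<^sub>R y) S"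
    \<comment> \<open>The level set of 0 may have infinite measure, so its indicator need not be
      integrable; its term is zero anyway.\<close>
    proof (cases "y = 0")
      case False
      have m: "{x\<in>S. s x = y} \<in> sets ?M"
        using sf y unfolding simple_function_def
        by (auto simp: vimage_def Int_def conj_commute)
      have "emeasure ?M {x\<in>S. s x = y} \<le> emeasure ?M {y\<in>space ?M. s y \<noteq> 0}"
        using False measurable_sets[OF measurable_simple_function[OF sf], of "-{0}"]
        by (intro emeasure_mono) (auto simp: vimage_def Int_def conj_commute)
      then have "emeasure ?M {x\<in>S. s x = y} < \<infinity>" using fin by (auto simp: top_unique less_top)
      then have "integrable ?M (indicator {x\<in>S. s x = y} :: _ \<Rightarrow> real)"
        using m by (intro integrable_real_indicator) auto
      from has_integral_integral_lebesgue_on[OF this S]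
      have "(indicator {x\<in>S. s x = y} has_integral measure ?M {x\<in>S. s x = y}) S"
        using m by (auto simp: Int_absorb2 subset_eq Int_def conj_commute cong: conj_cong)
      then show ?thesis by (rule has_integral_scaleR_left)
    qed simp
  qed
  moreover have "(\<Sum>y\<in>s`S. indicator {x\<in>S. s x = y} x *\<^sub>R y) = s x" if "x \<in> S" for x
  proof -
    have "(\<Sum>y\<in>s`S. indicator {x\<in>S. s x = y} x *\<^sub>R y) = (\<Sum>y\<in>s`S. if s x = y then y else 0)"
      using that by (intro sum.cong) (auto simp: indicator_def)
    also have "\<dots> = s x" using F that by simp
    finally show ?thesis .
  qed
  ultimately have "(s has_integral (\<Sum>y\<in>s`S. measure ?M {x\<in>S. s x = y} *\<^sub>R y)) S"
    by (rule has_integral_eq[rotated])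
  then show ?thesis by (simp add: Bochner_Integration.simple_bochner_integral_def)
qed

text \<open>Differences of measurable functions into a non-separable space need not be measurable;
  here one of the functions takes finitely many values only.\<close>

lemma borel_measurable_norm_diff_simple_function:
  fixes f s :: "'m \<Rightarrow> 'a::real_normed_vector"
  assumes f: "f \<in> borel_measurable M" and s: "simple_function M s"
  shows "(\<lambda>y. norm (f y - s y)) \<in> borel_measurable M"
proof (rule measurable_compose_countable'[where f = "\<lambda>i y. norm (f y - i)" and g = s])
  show "s \<in> measurable M (count_space (s ` space M))"
    using s by (simp add: simple_function_def measurable_count_space_eq2)
  show "countable (s ` space M)" using s by (simp add: simple_function_def countable_finite)
  have "continuous_on UNIV (\<lambda>z. norm (z - i))" for i :: 'a by (intro continuous_intros)
  then show "(\<lambda>y. norm (f y - i)) \<in> borel_measurable M" for i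
    using measurable_compose[OF f borel_measurable_continuous_onI] by blast
qed

lemma has_banach_integral_imp_has_integral:
  fixes f :: "'n::euclidean_space \<Rightarrow> 'a::banach"
  assumes S: "S \<in> sets lebesgue" "S \<subseteq> cbox a b"
    and f: "has_banach_integral (lebesgue_on S) f x"
  shows "(f has_integral x) S"
proof -
  let ?M = "lebesgue_on S"
  obtain s where fm: "f \<in> borel_measurable ?M" and s: "\<And>i::nat. Bochner_Integration.simple_bochner_integrable ?M (s i)"
    and lim: "(\<lambda>i. \<integral>\<^sup>+ y. ennreal (norm (f y - s i y)) \<partial>?M) \<longlonglongrightarrow> 0"
    and x: "(\<lambda>i. Bochner_Integration.simple_bochner_integral ?M (s i)) \<longlonglongrightarrow> x"
    using f unfolding has_banach_integral_def by blast
  have sf: "simple_function ?M (s i)" for i using s[of i] by (auto elim: Bochner_Integration.simple_bochner_integrable.cases)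
  have "\<forall>\<^sub>F i in sequentially. (\<integral>\<^sup>+ y. ennreal (norm (f y - s i y)) \<partial>?M) < 1"
    using lim by (rule order_tendstoD) simp
  then obtain N where N: "\<And>i. i \<ge> N \<Longrightarrow> (\<integral>\<^sup>+ y. ennreal (norm (f y - s i y)) \<partial>?M) < 1"
    by (auto simp: eventually_sequentially)
  \<comment> \<open>Finitely many of the mean distances may be infinite. The shift discards them, so
    that every \<open>norm (f y - t i y)\<close> is integrable.\<close>
  define t where "t i = s (i + N)" for i
  have I: "integrable ?M (\<lambda>y. norm (f y - t i y))" for i
  proof (rule integrableI_nonneg)
    show "(\<lambda>y. norm (f y - t i y)) \<in> borel_measurable ?M"
      unfolding t_def by (rule borel_measurable_norm_diff_simple_function[OF fm sf])
    show "(\<integral>\<^sup>+ y. ennreal (norm (f y - t i y)) \<partial>?M) < \<infinity>"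
      unfolding t_def by (rule less_le_trans[OF N]) auto
  qed simp
  \<comment> \<open>Extension by zero carries the problem from \<open>S\<close> to the surrounding
    box, where Riemann sums are available.\<close>
  let ?r = "\<lambda>g y. if y \<in> S then g y else 0"
  have "(?r f has_integral x) (cbox a b)"
  proof (rule has_integral_L1_limit)
    show "(?r (t i) has_integral Bochner_Integration.simple_bochner_integral ?M (t i)) (cbox a b)" for i
      using simple_bochner_integrable_has_integral[OF S(1) s] S(2) by (simp add: t_def)
    have "((\<lambda>y. norm (f y - t i y)) has_integral (integral\<^sup>L ?M (\<lambda>y. norm (f y - t i y)))) S" for i
      by (rule has_integral_integral_lebesgue_on[OF I S(1)])
    moreover have "norm (?r f y - ?r (t i) y) = ?r (\<lambda>y. norm (f y - t i y)) y" for i y by simp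
    ultimately show "((\<lambda>y. norm (?r f y - ?r (t i) y)) has_integral
        (integral\<^sup>L ?M (\<lambda>y. norm (f y - t i y)))) (cbox a b)" for i
      using S(2) by simp
    have "(\<lambda>i. \<integral>\<^sup>+ y. ennreal (norm (f y - t i y)) \<partial>?M) \<longlonglongrightarrow> 0"
      unfolding t_def using lim by (rule LIMSEQ_ignore_initial_segment)
    then have "(\<lambda>i. ennreal (integral\<^sup>L ?M (\<lambda>y. norm (f y - t i y)))) \<longlonglongrightarrow> ennreal 0"
      using I by (simp add: nn_integral_eq_integral)
    then show "(\<lambda>i. integral\<^sup>L ?M (\<lambda>y. norm (f y - t i y))) \<longlonglongrightarrow> 0"
      by (subst (asm) tendsto_ennreal_iff) auto
    show "(\<lambda>i. Bochner_Integration.simple_bochner_integral ?M (t i)) \<longlonglongrightarrow> x"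
      unfolding t_def using x by (rule LIMSEQ_ignore_initial_segment)
  qed
  then show ?thesis using S(2) by simp
qed

text \<open>The uniqueness that \<open>THE\<close> demands is inherited from the Henstock-Kurzweil
  integral.\<close>

lemma banach_integral_has_integral:
  fixes f :: "'n::euclidean_space \<Rightarrow> 'a::banach"
  assumes S: "S \<in> sets lebesgue" "S \<subseteq> cbox a b"
    and f: "banach_integrable (lebesgue_on S) f"
  shows "(f has_integral banach_integral (lebesgue_on S) f) S"
proof -
  obtain x where x: "has_banach_integral (lebesgue_on S) f x"
    using f unfolding banach_integrable_def by blast
  have "(THE x. has_banach_integral (lebesgue_on S) f x) = x"
  proof (rule the_equality)
    show "has_banach_integral (lebesgue_on S) f x" by (rule x)
    fix y assume "has_banach_integral (lebesgue_on S) f y"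
    then show "y = x"
      using has_integral_unique has_banach_integral_imp_has_integral[OF S] x by blast
  qed
  then show ?thesis using f has_banach_integral_imp_has_integral[OF S x] by (simp add: banach_integral_def)
qed


section \<open>Bochner integrability of an integrable kernel times a continuous function\<close>

text \<open>Completeness of the space supplies the value: two integrals of simple functions differ
  by at most the sum of the mean distances of these functions to \<open>f\<close>, so the integrals
  form a Cauchy sequence.\<close>

lemma banach_integrableI:
  fixes f :: "'m \<Rightarrow> 'a::banach"
  assumes f: "f \<in> borel_measurable M"
    and s: "\<And>i::nat. Bochner_Integration.simple_bochner_integrable M (s i)"
    and lim: "(\<lambda>i. \<integral>\<^sup>+ y. ennreal (norm (f y - s i y)) \<partial>M) \<longlonglongrightarrow> 0"
  shows "banach_integrable M f"
proof -
  let ?I = "\<lambda>i. Bochner_Integration.simple_bochner_integral M (s i)"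
  have sf: "simple_function M (s i)" for i
    using s[of i] by (auto elim: Bochner_Integration.simple_bochner_integrable.cases)
  note [measurable] = borel_measurable_norm_diff_simple_function[OF f sf]
  have bound: "ennreal (norm (?I i - ?I j)) \<le>
      (\<integral>\<^sup>+ y. ennreal (norm (f y - s i y)) \<partial>M) + (\<integral>\<^sup>+ y. ennreal (norm (f y - s j y)) \<partial>M)" for i j
  proof -
    have d: "Bochner_Integration.simple_bochner_integrable M (\<lambda>y. s i y - s j y)"
      by (rule simple_bochner_integrable_compose2[OF _ s s, of "(-)"]) simp
    have dn: "Bochner_Integration.simple_bochner_integrable M (\<lambda>y. norm (s i y - s j y))"
      by (rule simple_bochner_integrable_compose2[OF _ s s, of "\<lambda>x y. norm (x - y)"]) simp
    have "ennreal (norm (?I i - ?I j)) \<le>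
        ennreal (Bochner_Integration.simple_bochner_integral M (\<lambda>y. norm (s i y - s j y)))"
      unfolding simple_bochner_integral_diff[OF s s, symmetric]
      by (intro ennreal_leI simple_bochner_integral_norm_bound d)
    also have "\<dots> = (\<integral>\<^sup>+ y. ennreal (norm (s i y - s j y)) \<partial>M)"
      by (rule simple_bochner_integral_eq_nn_integral[OF dn]) simp
    also have "\<dots> \<le> (\<integral>\<^sup>+ y. ennreal (norm (f y - s i y)) + ennreal (norm (f y - s j y)) \<partial>M)"
    proof (rule nn_integral_mono)
      fix y
      have "norm (s i y - s j y) \<le> norm (f y - s i y) + norm (f y - s j y)"
        using norm_triangle_ineq4[of "f y - s j y" "f y - s i y"] by simp
      then show "ennreal (norm (s i y - s j y)) \<le> ennreal (norm (f y - s i y)) + ennreal (norm (f y - s j y))"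
        by (simp flip: ennreal_plus)
    qed
    also have "\<dots> = (\<integral>\<^sup>+ y. ennreal (norm (f y - s i y)) \<partial>M) + (\<integral>\<^sup>+ y. ennreal (norm (f y - s j y)) \<partial>M)"
      by (rule nn_integral_add) auto
    finally show ?thesis .
  qed
  have "Cauchy ?I"
  proof (rule CauchyI)
    fix \<epsilon> :: real assume "\<epsilon> > 0"
    then have "\<forall>\<^sub>F i in sequentially. (\<integral>\<^sup>+ y. ennreal (norm (f y - s i y)) \<partial>M) < ennreal (\<epsilon>/2)"
      by (intro order_tendstoD(2)[OF lim]) simp
    then obtain N where N: "\<And>i. i \<ge> N \<Longrightarrow> (\<integral>\<^sup>+ y. ennreal (norm (f y - s i y)) \<partial>M) < ennreal (\<epsilon>/2)"
      by (auto simp: eventually_sequentially)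
    have "norm (?I i - ?I j) < \<epsilon>" if "i \<ge> N" "j \<ge> N" for i j
    proof -
      have "ennreal (norm (?I i - ?I j)) < ennreal (\<epsilon>/2) + ennreal (\<epsilon>/2)"
        by (rule le_less_trans[OF bound add_strict_mono[OF N N]]) (use that in auto)
      then show ?thesis using \<open>\<epsilon> > 0\<close> by (simp add: ennreal_less_iff flip: ennreal_plus)
    qed
    then show "\<exists>N. \<forall>i\<ge>N. \<forall>j\<ge>N. norm (?I i - ?I j) < \<epsilon>" by blast
  qed
  then obtain x where "?I \<longlonglongrightarrow> x" using convergent_eq_Cauchy by blast
  then show ?thesis
    unfolding banach_integrable_def has_banach_integral_def using f s lim by blast
qed

text \<open>Rounding to a grid of mesh \<open>1 / N\<close> yields the step functions used below.
  Clamping \<open>s\<close> leaves finitely many grid cells on the whole real line, whatever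
  \<open>S\<close> is, and since \<open>f\<close> acts on the cell number it may be any function
  into any type.\<close>

lemma simple_function_grid:
  fixes a b N :: real
  assumes N: "0 \<le> N" and S: "S \<in> sets lebesgue"
  shows "simple_function (lebesgue_on S) (\<lambda>s. f \<lfloor>N * (min (max s a) b - a)\<rfloor>)"
proof -
  let ?g = "\<lambda>s. \<lfloor>N * (min (max s a) b - a)\<rfloor>"
  have "?g ` UNIV \<subseteq> {\<lfloor>N * (min a b - a)\<rfloor>..\<lfloor>N * (max a b - a)\<rfloor>}"
    using N by (auto intro!: floor_mono mult_left_mono)
  then have fin: "finite (range ?g)" by (rule finite_subset) simp
  have "?g \<in> measurable lborel (count_space UNIV)" by measurable
  then have m: "?g \<in> measurable (lebesgue_on S) (count_space UNIV)"
    by (intro measurable_restrict_space1 measurable_completion)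
  have "simple_function (lebesgue_on S) ?g"
    unfolding simple_function_def
  proof safe
    show "finite (?g ` space (lebesgue_on S))" using fin by (rule rev_finite_subset) auto
    show "?g -` {x} \<inter> space (lebesgue_on S) \<in> sets (lebesgue_on S)" for x
      by (rule measurable_sets[OF m]) simp
  qed
  then show ?thesis by (rule simple_function_compose1)
qed

lemma continuous_uniform_grid_approximation:
  fixes h :: "real \<Rightarrow> 'a::metric_space"
  assumes h: "continuous_on {a..b} h" and e: "e > 0"
  shows "\<exists>N::real. N > 0 \<and> (\<forall>s\<in>{a..b}. a + \<lfloor>N * (min (max s a) b - a)\<rfloor> / N \<in> {a..b} \<and>
    dist (h s) (h (a + \<lfloor>N * (min (max s a) b - a)\<rfloor> / N)) < e)"
proof -
  have "uniformly_continuous_on {a..b} h" using h by (rule compact_uniformly_continuous) simp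
  then obtain d where d: "d > 0" "\<And>x y. x \<in> {a..b} \<Longrightarrow> y \<in> {a..b} \<Longrightarrow> dist x y < d \<Longrightarrow> dist (h x) (h y) < e"
    using e unfolding uniformly_continuous_on_def by metis
  \<comment> \<open>The mesh is \<open>d / 2\<close>, so rounding down moves a point by less than
    \<open>d\<close>.\<close>
  define N where "N = 2 / d"
  have N: "N > 0" using d by (simp add: N_def)
  have mm: "min (max s a) b = s" if "s \<in> {a..b}" for s using that by auto
  have le: "\<lfloor>N * (s - a)\<rfloor> / N \<le> s - a" for s
    using N of_int_floor_le[of "N * (s - a)"] by (simp add: divide_le_eq mult.commute)
  have ge: "\<lfloor>N * (s - a)\<rfloor> / N > s - a - d" for s
  proof -
    have "N * (s - a - d) < N * (s - a) - 1" using d by (simp add: N_def field_simps)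
    also have "\<dots> < \<lfloor>N * (s - a)\<rfloor>" by linarith
    finally show ?thesis using N by (simp add: less_divide_eq mult.commute)
  qed
  have I: "a + \<lfloor>N * (s - a)\<rfloor> / N \<in> {a..b}" if "s \<in> {a..b}" for s
    using that le[of s] N by (auto intro!: divide_nonneg_pos mult_nonneg_nonneg)
  have "\<forall>s\<in>{a..b}. a + \<lfloor>N * (min (max s a) b - a)\<rfloor> / N \<in> {a..b} \<and>
    dist (h s) (h (a + \<lfloor>N * (min (max s a) b - a)\<rfloor> / N)) < e"
  proof
    fix s assume s: "s \<in> {a..b}"
    have "dist (h s) (h (a + \<lfloor>N * (s - a)\<rfloor> / N)) < e"
      using le[of s] ge[of s] by (intro d s I) (auto simp: dist_real_def)
    then show "a + \<lfloor>N * (min (max s a) b - a)\<rfloor> / N \<in> {a..b} \<and>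
        dist (h s) (h (a + \<lfloor>N * (min (max s a) b - a)\<rfloor> / N)) < e"
      using I[OF s] unfolding mm[OF s] by blast
  qed
  then show ?thesis using N by blast
qed


text \<open>This is the source of all Bochner integrals in the proof; \<open>k\<close> may be the
  singular kernel. It is approximated in mean by simple functions \<open>r i\<close>,
  \<open>h\<close> uniformly by step functions \<open>H i\<close>, and the products
  \<open>r i y *\<^sub>R H i y\<close> are simple again.\<close>

lemma banach_integrable_scaleR_continuous:
  fixes k :: "real \<Rightarrow> real" and h :: "real \<Rightarrow> 'a::banach"
  assumes S: "S \<in> sets lebesgue" "S \<subseteq> {a..b}"
    and k: "integrable (lebesgue_on S) k" and h: "continuous_on {a..b} h"
  shows "banach_integrable (lebesgue_on S) (\<lambda>s. k s *\<^sub>R h s)"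
proof -
  let ?M = "lebesgue_on S"
  obtain r where r: "\<And>i::nat. Bochner_Integration.simple_bochner_integrable ?M (r i)"
    and rl: "(\<lambda>i. \<integral>\<^sup>+ y. ennreal (norm (k y - r i y)) \<partial>?M) \<longlonglongrightarrow> 0"
    using k unfolding integrable.simps has_bochner_integral.simps by blast
  have km[measurable]: "k \<in> borel_measurable ?M" using k by simp
  have rs: "simple_function ?M (r i)" for i
    using r[of i] by (auto elim: Bochner_Integration.simple_bochner_integrable.cases)
  have rm[measurable]: "r i \<in> borel_measurable ?M" for i
    by (rule borel_measurable_simple_function[OF rs])
  obtain N :: "nat \<Rightarrow> real" where N': "\<forall>i. N i > 0 \<and> (\<forall>s\<in>{a..b}.
      a + \<lfloor>N i * (min (max s a) b - a)\<rfloor> / N i \<in> {a..b} \<and>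
      dist (h s) (h (a + \<lfloor>N i * (min (max s a) b - a)\<rfloor> / N i)) < 1 / real (Suc i))"
    by (rule exE[OF choice[OF allI[OF continuous_uniform_grid_approximation[OF h]]], of "\<lambda>i. 1 / real (Suc i)"]) simp_all
  then have N: "\<And>i. N i > 0"
    "\<And>i s. s \<in> {a..b} \<Longrightarrow> a + \<lfloor>N i * (min (max s a) b - a)\<rfloor> / N i \<in> {a..b}"
    "\<And>i s. s \<in> {a..b} \<Longrightarrow> dist (h s) (h (a + \<lfloor>N i * (min (max s a) b - a)\<rfloor> / N i)) < 1 / real (Suc i)"
    by blast+
  define H where "H i s = h (a + \<lfloor>N i * (min (max s a) b - a)\<rfloor> / N i)" for i s
  have H: "norm (h s - H i s) \<le> 1 / real (Suc i)" if "s \<in> S" for i s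
    using N(3)[of s i] that S(2) by (auto simp: H_def dist_norm)
  have Hs: "simple_function ?M (H i)" for i
    unfolding H_def using simple_function_grid[OF less_imp_le[OF N(1)] S(1), of "\<lambda>m. h (a + of_int m / N i)"] .
  have "compact (h ` {a..b})" using h by (intro compact_continuous_image) auto
  then obtain B where B: "B > 0" "\<And>s. s \<in> {a..b} \<Longrightarrow> norm (h s) \<le> B"
    using bounded_pos[of "h ` {a..b}"] compact_imp_bounded by auto
  have HB: "norm (H i s) \<le> B" if "s \<in> S" for i s
    unfolding H_def using that S(2) by (intro B(2) N(2)) auto
  have fin: "emeasure ?M (space ?M) < \<infinity>"
  proof -
    have "emeasure lebesgue S \<le> emeasure lebesgue {a..b}" using S by (intro emeasure_mono) auto
    also have "\<dots> < \<infinity>" by (simp add: emeasure_lborel_Icc_eq)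
    finally show ?thesis using S(1) by (simp add: emeasure_restrict_space space_restrict_space)
  qed
  show ?thesis
  proof (rule banach_integrableI[where s = "\<lambda>i y. r i y *\<^sub>R H i y"])
    \<comment> \<open>Without separability, a product of measurable functions into the space need
      not be measurable. Here \<open>H i\<close> has finitely many values, so the product is glued
      from the functions \<open>k y *\<^sub>R z\<close> with fixed \<open>z\<close>; the product
      with \<open>h\<close> is then a pointwise limit.\<close>
    have m: "(\<lambda>s. k s *\<^sub>R H i s) \<in> borel_measurable ?M" for i
    proof (rule measurable_compose_countable'[where f = "\<lambda>z y. k y *\<^sub>R z" and g = "H i"])
      show "H i \<in> measurable ?M (count_space (H i ` space ?M))"
        using Hs[of i] unfolding simple_function_def by (subst measurable_count_space_eq2) auto
      show "countable (H i ` space ?M)" using Hs[of i] unfolding simple_function_def by (intro countable_finite) blast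
      have "continuous_on UNIV (\<lambda>c::real. c *\<^sub>R z)" for z :: 'a by (intro continuous_intros)
      then show "(\<lambda>y. k y *\<^sub>R z) \<in> borel_measurable ?M" for z :: 'a
        by (rule measurable_compose[OF km borel_measurable_continuous_onI])
    qed
    show "(\<lambda>s. k s *\<^sub>R h s) \<in> borel_measurable ?M"
    proof (rule borel_measurable_LIMSEQ_metric[OF m])
      fix s assume "s \<in> space ?M"
      then have "norm (H i s - h s) \<le> 1 / real (Suc i)" for i
        using H by (simp add: norm_minus_commute space_restrict_space)
      then have "(\<lambda>i. H i s - h s) \<longlonglongrightarrow> 0"
        by (intro Lim_null_comparison[OF always_eventually LIMSEQ_Suc[OF lim_1_over_n]]) auto
      then have "(\<lambda>i. H i s) \<longlonglongrightarrow> h s" by (simp add: LIM_zero_iff)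
      then show "(\<lambda>i. k s *\<^sub>R H i s) \<longlonglongrightarrow> k s *\<^sub>R h s" by (intro tendsto_intros)
    qed
    show "Bochner_Integration.simple_bochner_integrable ?M (\<lambda>y. r i y *\<^sub>R H i y)" for i
    proof (rule Bochner_Integration.simple_bochner_integrable.intros)
      show sf: "simple_function ?M (\<lambda>y. r i y *\<^sub>R H i y)"
        by (rule simple_function_compose2[OF rs Hs])
      have "emeasure ?M {y\<in>space ?M. r i y *\<^sub>R H i y \<noteq> 0} \<le> emeasure ?M (space ?M)"
        by (rule emeasure_space)
      then show "emeasure ?M {y\<in>space ?M. r i y *\<^sub>R H i y \<noteq> 0} \<noteq> \<infinity>" using fin by (auto simp: top_unique)
    qed
    let ?U = "\<lambda>i. ennreal (1 / real (Suc i)) * (\<integral>\<^sup>+ y. ennreal (norm (k y)) \<partial>?M)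
        + ennreal B * (\<integral>\<^sup>+ y. ennreal (norm (k y - r i y)) \<partial>?M)"
    have le: "(\<integral>\<^sup>+ y. ennreal (norm (k y *\<^sub>R h y - r i y *\<^sub>R H i y)) \<partial>?M) \<le> ?U i" for i
    proof -
      have "(\<integral>\<^sup>+ y. ennreal (norm (k y *\<^sub>R h y - r i y *\<^sub>R H i y)) \<partial>?M) \<le>
         (\<integral>\<^sup>+ y. ennreal (1 / real (Suc i)) * ennreal (norm (k y)) + ennreal B * ennreal (norm (k y - r i y)) \<partial>?M)"
      proof (rule nn_integral_mono)
        fix y assume "y \<in> space ?M"
        then have y: "y \<in> S" by (simp add: space_restrict_space)
        \<comment> \<open>The error splits into one part that is small because \<open>H i\<close> is
          uniformly close to \<open>h\<close>, and one that is small because \<open>r i\<close> is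
          close to \<open>k\<close> in mean and \<open>H i\<close> is bounded by
          \<open>B\<close>.\<close>
        have "k y *\<^sub>R h y - r i y *\<^sub>R H i y = k y *\<^sub>R (h y - H i y) + (k y - r i y) *\<^sub>R H i y"
          by (simp add: algebra_simps)
        then have "norm (k y *\<^sub>R h y - r i y *\<^sub>R H i y) \<le> \<bar>k y\<bar> * norm (h y - H i y) + \<bar>k y - r i y\<bar> * norm (H i y)"
          by (metis norm_scaleR norm_triangle_ineq)
        also have "\<dots> \<le> \<bar>k y\<bar> * (1 / real (Suc i)) + \<bar>k y - r i y\<bar> * B"
          using H[OF y] HB[OF y] by (intro add_mono mult_left_mono) auto
        finally show "ennreal (norm (k y *\<^sub>R h y - r i y *\<^sub>R H i y)) \<le>
            ennreal (1 / real (Suc i)) * ennreal (norm (k y)) + ennreal B * ennreal (norm (k y - r i y))"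
          using B(1) unfolding mult.commute[of "ennreal _" "ennreal (norm _)"]
          by (simp add: mult.commute ennreal_leI ennreal_mult'[symmetric] ennreal_plus[symmetric] del: of_nat_Suc ennreal_plus)
      qed
      also have "\<dots> = ?U i"
        by (subst nn_integral_add) (auto simp: nn_integral_cmult)
      finally show ?thesis .
    qed
    \<comment> \<open>Multiplication in \<open>ennreal\<close> is discontinuous at 0 times infinity;
      finiteness of this integral excludes that case.\<close>
    have kf: "(\<integral>\<^sup>+ y. ennreal (norm (k y)) \<partial>?M) < top"
      using k by (simp add: integrable_iff_bounded)
    have "(\<lambda>i. ennreal (1 / real (Suc i))) \<longlonglongrightarrow> 0"
      using tendsto_ennrealI[OF LIMSEQ_Suc[OF lim_1_over_n[where 'a = real]]] by simp
    then have "(\<lambda>i. ennreal (1 / real (Suc i)) * (\<integral>\<^sup>+ y. ennreal (norm (k y)) \<partial>?M)) \<longlonglongrightarrow> 0 * (\<integral>\<^sup>+ y. ennreal (norm (k y)) \<partial>?M)"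
      using kf by (intro tendsto_mult_ennreal tendsto_const) auto
    moreover have "(\<lambda>i. ennreal B * (\<integral>\<^sup>+ y. ennreal (norm (k y - r i y)) \<partial>?M)) \<longlonglongrightarrow> ennreal B * 0"
      by (intro tendsto_mult_ennreal tendsto_const rl) auto
    ultimately have U: "?U \<longlonglongrightarrow> 0 * (\<integral>\<^sup>+ y. ennreal (norm (k y)) \<partial>?M) + ennreal B * 0"
      by (rule tendsto_add)
    show "(\<lambda>i. \<integral>\<^sup>+ y. ennreal (norm (k y *\<^sub>R h y - r i y *\<^sub>R H i y)) \<partial>?M) \<longlonglongrightarrow> 0"
    proof (rule tendsto_sandwich[OF _ _ tendsto_const])
      show "?U \<longlonglongrightarrow> 0" using U by simp
      show "\<forall>\<^sub>F i in sequentially. (\<integral>\<^sup>+ y. ennreal (norm (k y *\<^sub>R h y - r i y *\<^sub>R H i y)) \<partial>?M) \<le> ?U i"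
        using le by (intro always_eventually allI)
    qed simp
  qed
qed

section \<open>Test functions and weak derivatives\<close>

lemma integrable_lebesgue_on_one:
  assumes "S \<in> sets lebesgue" "S \<subseteq> {a..b::real}"
  shows "integrable (lebesgue_on S) (\<lambda>_. 1::real)"
proof -
  have "S \<in> lmeasurable"
    using assms by (intro bounded_set_imp_lmeasurable bounded_subset[OF bounded_closed_interval])
  then have "(\<lambda>_. 1::real) absolutely_integrable_on S"
    by (intro nonnegative_absolutely_integrable_1) (auto simp: lmeasurable_iff_integrable_on)
  then show ?thesis using assms(1) by (rule absolutely_integrable_imp_integrable)
qed

lemma banach_integrable_continuous:
  fixes h :: "real \<Rightarrow> 'a::banach"
  assumes "S \<in> sets lebesgue" "S \<subseteq> {a..b}" "continuous_on {a..b} h"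
  shows "banach_integrable (lebesgue_on S) h"
  using banach_integrable_scaleR_continuous[OF assms(1,2) integrable_lebesgue_on_one[OF assms(1,2)] assms(3)]
  by simp

lemma banach_integral_open_interval:
  fixes h :: "real \<Rightarrow> 'a::banach"
  assumes "continuous_on {a..b} h"
  shows "banach_integral (lebesgue_on {a<..<b}) h = integral {a..b} h"
proof -
  have "banach_integrable (lebesgue_on {a<..<b}) h"
    by (rule banach_integrable_continuous[OF _ _ assms]) auto
  then have "(h has_integral banach_integral (lebesgue_on {a<..<b}) h) {a<..<b}"
    by (intro banach_integral_has_integral[where a = a and b = b]) auto
  then show ?thesis by (simp add: integral_open_interval_real integral_unique)
qed

lemma banach_integral_closed_interval:
  fixes h :: "real \<Rightarrow> 'a::banach"
  assumes "integrable (lebesgue_on {a..b}) k" "continuous_on {a..b} h"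
  shows "((\<lambda>s. k s *\<^sub>R h s) has_integral banach_integral (lebesgue_on {a..b}) (\<lambda>s. k s *\<^sub>R h s)) {a..b}"
  by (rule banach_integral_has_integral[where a = a and b = b, OF _ _ banach_integrable_scaleR_continuous])
    (use assms in auto)

lemma locally_integrable_continuous:
  fixes h :: "real \<Rightarrow> 'a::banach"
  assumes "continuous_on {a..b} h"
  shows "locally_integrable a b h"
  unfolding locally_integrable_def
proof (intro allI impI)
  fix c d assume "a < c \<and> d < b"
  then show "banach_integrable (lebesgue_on {c..d}) h"
    by (intro banach_integrable_continuous[OF _ _ assms]) auto
qed

section \<open>Smooth bump functions\<close>

text \<open>The products \<open>x\<^bsup>-k\<^esup> exp (-1/x)\<close>, extended by zero, generate a class of functions closed under
  differentiation, which makes all its members smooth.\<close>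

definition flat :: "nat \<Rightarrow> real \<Rightarrow> real" where
  "flat k x = (if x \<le> 0 then 0 else (1 / x) ^ k * exp (- (1 / x)))"

text \<open>With \<open>y = 1 / x\<close>, the exponential contributes a factor \<open>y ^ 2\<close>
  and the power a factor \<open>- k * y\<close>, so the derivative stays in the family. At 0 the
  difference quotient is again a power of \<open>y\<close> times \<open>exp (- y)\<close>, and the
  exponential wins.\<close>

lemma flat_has_derivative:
  "(flat k has_real_derivative flat (k + 2) x - real k * flat (k + 1) x) (at x)"
proof (cases x "0::real" rule: linorder_cases)
  case less
  have "((\<lambda>_. 0) has_real_derivative 0) (at x)" by simp
  then have "(flat k has_real_derivative 0) (at x)"
    by (rule has_field_derivative_transform_within_open[where S = "{..<0}"]) (use less in \<open>auto simp: flat_def\<close>)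
  then show ?thesis using less by (simp add: flat_def)
next
  case greater
  have "((\<lambda>x. inverse x ^ k * exp (- inverse x)) has_real_derivative
     real k * inverse x ^ (k - 1) * - (inverse x ^ 2) * exp (- inverse x) +
       exp (- inverse x) * inverse x ^ 2 * inverse x ^ k) (at x)"
    using greater by (auto intro!: derivative_eq_intros simp: power2_eq_square)
  moreover have "real k * inverse x ^ (k - 1) * - (inverse x ^ 2) * exp (- inverse x) +
       exp (- inverse x) * inverse x ^ 2 * inverse x ^ k = flat (k + 2) x - real k * flat (k + 1) x"
    using greater by (cases k) (simp_all add: flat_def inverse_eq_divide power_add algebra_simps add_divide_distrib power2_eq_square)
  ultimately have "((\<lambda>x. inverse x ^ k * exp (- inverse x)) has_real_derivative
     flat (k + 2) x - real k * flat (k + 1) x) (at x)" by simp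
  then show ?thesis
    by (rule has_field_derivative_transform_within_open[where S = "{0<..}"])
      (use greater in \<open>auto simp: flat_def inverse_eq_divide\<close>)
next
  case equal
  have "((\<lambda>h. flat k h / h) \<longlongrightarrow> 0) (at 0)"
  proof (rule filterlim_split_at)
    have "\<forall>\<^sub>F h in at_left 0. (0::real) = flat k h / h"
      by (simp add: flat_def eventually_at_filter)
    then show "((\<lambda>h. flat k h / h) \<longlongrightarrow> 0) (at_left 0)"
      by (rule Lim_transform_eventually[OF tendsto_const])
    have "((\<lambda>h::real. inverse h ^ Suc k / exp (inverse h)) \<longlongrightarrow> 0) (at_right 0)"
      by (rule filterlim_compose[OF tendsto_power_div_exp_0 filterlim_inverse_at_top_right])
    moreover have "\<forall>\<^sub>F h in at_right 0. inverse h ^ Suc k / exp (inverse h) = flat k h / h"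
      by (simp add: flat_def eventually_at_filter exp_minus field_simps)
    ultimately show "((\<lambda>h. flat k h / h) \<longlongrightarrow> 0) (at_right 0)"
      by (rule Lim_transform_eventually)
  qed
  then show ?thesis using equal by (simp add: has_field_derivative_iff flat_def)
qed

text \<open>The affine argument \<open>c * x + e\<close> admits translates and reflections, which a
  bump needs at its two ends.\<close>

inductive flat_expr :: "(real \<Rightarrow> real) \<Rightarrow> bool" where
  flat: "flat_expr (\<lambda>x. flat k (c * x + e))"
| const: "flat_expr (\<lambda>x. c)"
| add: "flat_expr f \<Longrightarrow> flat_expr g \<Longrightarrow> flat_expr (\<lambda>x. f x + g x)"
| mult: "flat_expr f \<Longrightarrow> flat_expr g \<Longrightarrow> flat_expr (\<lambda>x. f x * g x)"

lemma flat_expr_has_derivative: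
  "flat_expr f \<Longrightarrow> \<exists>f'. flat_expr f' \<and> (\<forall>x. (f has_real_derivative f' x) (at x))"
proof (induction rule: flat_expr.induct)
  case (flat k c e)
  let ?f = "\<lambda>x. c * (flat (k + 2) (c * x + e) + (- real k) * flat (k + 1) (c * x + e))"
  have "flat_expr ?f" by (intro flat_expr.intros)
  moreover have "((\<lambda>x. flat k (c * x + e)) has_real_derivative ?f x) (at x)" for x
    by (rule DERIV_cong[OF DERIV_chain'[OF _ flat_has_derivative]])
      (auto intro!: derivative_eq_intros)
  ultimately show ?case by blast
next
  case (const c)
  then show ?case by (intro exI[of _ "\<lambda>_. 0"]) (auto intro: flat_expr.intros)
next
  case (add f g)
  then obtain f' g' where *: "flat_expr f'" "flat_expr g'" "\<And>x. (f has_real_derivative f' x) (at x)"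
    "\<And>x. (g has_real_derivative g' x) (at x)" by blast
  then show ?case
    by (intro exI[of _ "\<lambda>x. f' x + g' x"]) (auto intro!: flat_expr.intros derivative_intros)
next
  case (mult f g)
  then obtain f' g' where *: "flat_expr f'" "flat_expr g'" "\<And>x. (f has_real_derivative f' x) (at x)"
    "\<And>x. (g has_real_derivative g' x) (at x)" by blast
  then show ?case using mult(1,2)
    by (intro exI[of _ "\<lambda>x. f' x * g x + g' x * f x"]) (auto intro!: flat_expr.intros DERIV_mult)
qed

lemma flat_expr_smooth:
  assumes "flat_expr f"
  shows "(deriv ^^ k) f field_differentiable at x"
proof -
  have "flat_expr ((deriv ^^ k) f)"
  proof (induction k)
    case (Suc k)
    obtain f' where "flat_expr f'" "\<And>x. ((deriv ^^ k) f has_real_derivative f' x) (at x)"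
      using flat_expr_has_derivative[OF Suc] by blast
    moreover from this have "deriv ((deriv ^^ k) f) = f'" by (intro ext DERIV_imp_deriv)
    ultimately show ?case by simp
  qed (simp add: assms)
  then show ?thesis using flat_expr_has_derivative field_differentiable_def by blast
qed

lemma test_function_bump:
  assumes "a < c" "c < d" "d < b"
  obtains \<phi> where "test_function a b \<phi>" "\<And>x. \<phi> x \<ge> 0" "\<And>x. \<phi> x > 0 \<longleftrightarrow> x \<in> {c<..<d}"
proof -
  \<comment> \<open>Both factors are written in the affine form of \<open>flat_expr\<close>; they
    are \<open>flat 0 (x - c)\<close> and \<open>flat 0 (d - x)\<close>.\<close>
  define \<phi> where "\<phi> x = flat 0 (1 * x + - c) * flat 0 (- 1 * x + d)" for x
  have "flat_expr \<phi>" unfolding \<phi>_def by (intro flat_expr.intros)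
  moreover have pos: "\<phi> x > 0 \<longleftrightarrow> x \<in> {c<..<d}" and nonneg: "\<phi> x \<ge> 0" for x
    by (auto simp: \<phi>_def flat_def)
  moreover have "{x. \<phi> x \<noteq> 0} = {c<..<d}" by (auto simp: \<phi>_def flat_def)
  moreover have "closure {c<..<d} \<subseteq> {a<..<b}" using assms by auto
  ultimately have "test_function a b \<phi>"
    unfolding test_function_def by (simp only: flat_expr_smooth simp_thms)
  then show thesis using that pos nonneg by blast
qed

lemma test_function_has_derivative:
  "test_function a b \<phi> \<Longrightarrow> (\<phi> has_real_derivative deriv \<phi> x) (at x)"
  unfolding test_function_def DERIV_deriv_iff_field_differentiable
  by (auto dest: spec[of _ 0])

lemma test_function_continuous:
  "test_function a b \<phi> \<Longrightarrow> continuous_on S \<phi>"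
  by (meson DERIV_continuous_on has_field_derivative_at_within test_function_has_derivative)

lemma test_function_eq_0:
  assumes "test_function a b \<phi>" "x \<notin> {a<..<b}"
  shows "\<phi> x = 0"
  using assms closure_subset[of "{x. \<phi> x \<noteq> 0}"] unfolding test_function_def by auto

lemma test_function_deriv:
  assumes "test_function a b \<phi>"
  shows "test_function a b (deriv \<phi>)"
  unfolding test_function_def
proof safe
  fix k x show "(deriv ^^ k) (deriv \<phi>) field_differentiable at x"
    using assms unfolding test_function_def by (auto dest: spec[of _ "Suc k"] simp: funpow_Suc_right simp del: funpow.simps)
next
  let ?S = "closure {x. \<phi> x \<noteq> 0}"
  have "{x. deriv \<phi> x \<noteq> 0} \<subseteq> ?S"
  proof (safe, rule ccontr)
    fix x assume x: "x \<notin> ?S" "deriv \<phi> x \<noteq> 0"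
    have "((\<lambda>_. 0) has_real_derivative 0) (at x)" by simp
    then have "(\<phi> has_real_derivative 0) (at x)"
      by (rule has_field_derivative_transform_within_open[where S = "- ?S"])
        (use x closure_subset[of "{x. \<phi> x \<noteq> 0}"] in auto)
    then show False using x DERIV_imp_deriv by blast
  qed
  then have "closure {x. deriv \<phi> x \<noteq> 0} \<subseteq> ?S" by (simp add: closure_minimal)
  also have "\<dots> \<subseteq> {a<..<b}" using assms by (simp add: test_function_def)
  finally show "x \<in> {a<..<b}" if "x \<in> closure {x. deriv \<phi> x \<noteq> 0}" for x using that by blast
qed

lemma test_function_higher_deriv:
  "test_function a b \<phi> \<Longrightarrow> test_function a b ((deriv ^^ k) \<phi>)"
  by (induction k) (auto intro: test_function_deriv)

section \<open>Weak derivatives: uniqueness and uniform limits\<close>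

text \<open>Vectors have no sign, so an estimate replaces the usual positivity argument. If
  \<open>D x\<close> is not 0, take a bump of mass \<open>I > 0\<close> supported where
  \<open>D\<close> differs from \<open>D x\<close> by less than \<open>norm (D x) / 2\<close>. The
  integral of \<phi> times \<open>D\<close> is zero, so \<open>I * norm (D x)\<close> is the norm of
  the integral of \<phi> times \<open>D x - D\<close>, hence at most
  \<open>I * norm (D x) / 2\<close>. The end points follow by continuity.\<close>

lemma fundamental_lemma_variations:
  fixes D :: "real \<Rightarrow> 'a::banach"
  assumes "a < b" and D: "continuous_on {a..b} D"
    and zero: "\<And>\<phi>. test_function a b \<phi> \<Longrightarrow> integral {a..b} (\<lambda>t. \<phi> t *\<^sub>R D t) = 0"
    and t: "t \<in> {a..b}"
  shows "D t = 0"
proof (rule continuous_constant_on_closure[where S = "{a<..<b}" and f = D])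
  show "continuous_on (closure {a<..<b}) D" "t \<in> closure {a<..<b}" using assms by auto
next
  fix x assume x: "x \<in> {a<..<b}"
  show "D x = 0"
  proof (rule ccontr)
    assume nz: "D x \<noteq> 0"
    have "isCont D x" using D x by (intro continuous_on_interior[of "{a..b}"]) auto
    then obtain r where r: "r > 0" "\<And>y. dist y x < r \<Longrightarrow> dist (D y) (D x) < norm (D x) / 2"
      unfolding continuous_at_eps_delta using nz by (metis half_gt_zero zero_less_norm_iff)
    define q where "q = min r (min (x - a) (b - x)) / 2"
    have "q > 0" "q \<le> r / 2" "q \<le> (x - a) / 2" "q \<le> (b - x) / 2" using r(1) x by (auto simp: q_def)
    then have q: "q > 0" "q < r" "a < x - q" "x + q < b" using r(1) x by (auto simp: field_simps)
    obtain \<phi> where \<phi>: "test_function a b \<phi>" "\<And>y. \<phi> y \<ge> 0" "\<And>y. \<phi> y > 0 \<longleftrightarrow> y \<in> {x-q<..<x+q}"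
      by (rule test_function_bump[of a "x - q" "x + q" b]) (use q in auto)
    note c\<phi> = test_function_continuous[OF \<phi>(1)]
    have "integral {a..b} \<phi> \<noteq> 0"
      using integral_eq_0_iff[OF c\<phi> \<open>a < b\<close>] \<phi>(2) \<phi>(3)[of x] x q(1) by force
    moreover have "integral {a..b} \<phi> \<ge> 0"
      using \<phi>(2) by (intro integral_nonneg integrable_continuous_real c\<phi>) auto
    ultimately have I: "integral {a..b} \<phi> > 0" by simp
    have "integral {a..b} \<phi> *\<^sub>R D x = integral {a..b} (\<lambda>y. \<phi> y *\<^sub>R D x) - integral {a..b} (\<lambda>y. \<phi> y *\<^sub>R D y)"
      unfolding zero[OF \<phi>(1)] diff_zero
      by (rule integral_unique[OF has_integral_scaleR_left[OF integrable_integral[OF integrable_continuous_real[OF c\<phi>]]], symmetric])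
    also have "\<dots> = integral {a..b} (\<lambda>y. \<phi> y *\<^sub>R D x - \<phi> y *\<^sub>R D y)"
      by (intro integral_diff[symmetric] integrable_continuous_real continuous_intros c\<phi> D)
    also have "norm \<dots> \<le> integral {a..b} (\<lambda>y. \<phi> y * (norm (D x) / 2))"
    proof (rule integral_norm_bound_integral)
      fix y assume "y \<in> {a..b}"
      have "norm (\<phi> y *\<^sub>R D x - \<phi> y *\<^sub>R D y) = \<phi> y * norm (D y - D x)"
        using \<phi>(2) by (simp flip: scaleR_diff_right add: norm_minus_commute)
      also have "\<dots> \<le> \<phi> y * (norm (D x) / 2)"
      proof (cases "\<phi> y = 0")
        case False
        then have "y \<in> {x-q<..<x+q}" using \<phi>(2,3) less_le by metis
        then have "dist y x < r" using q by (auto simp: dist_real_def)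
        from r(2)[OF this] show ?thesis using \<phi>(2) by (intro mult_left_mono) (auto simp: dist_norm)
      qed simp
      finally show "norm (\<phi> y *\<^sub>R D x - \<phi> y *\<^sub>R D y) \<le> \<phi> y * (norm (D x) / 2)" .
    qed (intro integrable_continuous_real continuous_intros c\<phi> D)+
    also have "\<dots> = integral {a..b} \<phi> * (norm (D x) / 2)" by simp
    finally show False using I nz by simp
  qed
qed

lemma has_weak_deriv_unique:
  fixes w1 w2 :: "real \<Rightarrow> 'a::banach"
  assumes "a < b" "has_weak_deriv a b m u w1" "has_weak_deriv a b m u w2"
    and c: "continuous_on {a..b} w1" "continuous_on {a..b} w2" and t: "t \<in> {a..b}"
  shows "w1 t = w2 t"
proof -
  have "w1 t - w2 t = 0"
  proof (rule fundamental_lemma_variations[OF \<open>a < b\<close> _ _ t])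
    show "continuous_on {a..b} (\<lambda>t. w1 t - w2 t)" by (intro continuous_intros c)
    fix \<phi> assume \<phi>: "test_function a b \<phi>"
    note c\<phi> = continuous_on_scaleR[OF test_function_continuous[OF \<phi>]]
    have "(- 1) ^ m *\<^sub>R banach_integral (lebesgue_on {a<..<b}) (\<lambda>t. \<phi> t *\<^sub>R w1 t) =
        (- 1) ^ m *\<^sub>R banach_integral (lebesgue_on {a<..<b}) (\<lambda>t. \<phi> t *\<^sub>R w2 t)"
      using assms(2,3) \<phi> by (auto simp: has_weak_deriv_def)
    then have "(- 1) ^ m *\<^sub>R integral {a..b} (\<lambda>t. \<phi> t *\<^sub>R w1 t) = (- 1) ^ m *\<^sub>R integral {a..b} (\<lambda>t. \<phi> t *\<^sub>R w2 t)"
      by (simp only: banach_integral_open_interval[OF c\<phi>[OF c(1)]] banach_integral_open_interval[OF c\<phi>[OF c(2)]])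
    then have "integral {a..b} (\<lambda>t. \<phi> t *\<^sub>R w1 t) = integral {a..b} (\<lambda>t. \<phi> t *\<^sub>R w2 t)" by simp
    then show "integral {a..b} (\<lambda>t. \<phi> t *\<^sub>R (w1 t - w2 t)) = 0"
      unfolding scaleR_diff_right
      by (subst integral_diff) (auto intro!: integrable_continuous_real c\<phi> c)
  qed
  then show ?thesis by simp
qed

lemma has_vector_derivative_continuous_on:
  "(\<And>t. t \<in> S \<Longrightarrow> (f has_vector_derivative f' t) (at t within S)) \<Longrightarrow> continuous_on S f"
  unfolding continuous_on_eq_continuous_within by (intro ballI has_vector_derivative_continuous)

text \<open>Integration by parts moves one derivative at a time; test functions vanish at both end
  points. The derivatives are given as a chain \<open>V j\<close>, so that explicit formulas can be
  used for them.\<close>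

lemma integral_higher_deriv_test_function:
  fixes V :: "nat \<Rightarrow> real \<Rightarrow> 'a::banach"
  assumes "a < b"
    and "\<And>j t. j < m \<Longrightarrow> t \<in> {a..b} \<Longrightarrow> (V j has_vector_derivative V (Suc j) t) (at t within {a..b})"
    and "continuous_on {a..b} (V m)" and "test_function a b \<phi>"
  shows "integral {a..b} (\<lambda>t. (deriv ^^ m) \<phi> t *\<^sub>R V 0 t) =
    (- 1) ^ m *\<^sub>R integral {a..b} (\<lambda>t. \<phi> t *\<^sub>R V m t)"
  using assms(2-)
proof (induction m arbitrary: \<phi>)
  case (Suc m)
  have d: "(V m has_vector_derivative V (Suc m) t) (at t within {a..b})" if "t \<in> {a..b}" for t
    using Suc.prems(1) that by simp
  then have c: "continuous_on {a..b} (V m)"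
    by (rule has_vector_derivative_continuous_on)
  let ?\<phi>' = "deriv \<phi>"
  note c1 = test_function_continuous[OF Suc.prems(3)]
  note c2 = test_function_continuous[OF test_function_deriv[OF Suc.prems(3)]]
  have "((\<lambda>t. \<phi> t *\<^sub>R V (Suc m) t + ?\<phi>' t *\<^sub>R V m t) has_integral
      \<phi> b *\<^sub>R V m b - \<phi> a *\<^sub>R V m a) {a..b}"
  proof (rule fundamental_theorem_of_calculus)
    fix t assume t: "t \<in> {a..b}"
    show "((\<lambda>t. \<phi> t *\<^sub>R V m t) has_vector_derivative \<phi> t *\<^sub>R V (Suc m) t + ?\<phi>' t *\<^sub>R V m t) (at t within {a..b})"
      by (rule has_vector_derivative_scaleR[OF has_field_derivative_at_within[OF
            test_function_has_derivative[OF Suc.prems(3)]] d[OF t]])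
  qed (use \<open>a < b\<close> in simp)
  then have "integral {a..b} (\<lambda>t. \<phi> t *\<^sub>R V (Suc m) t + ?\<phi>' t *\<^sub>R V m t) = 0"
    using test_function_eq_0[OF Suc.prems(3)] by (simp add: integral_unique)
  then have "integral {a..b} (\<lambda>t. \<phi> t *\<^sub>R V (Suc m) t) + integral {a..b} (\<lambda>t. ?\<phi>' t *\<^sub>R V m t) = 0"
    by (subst integral_add[symmetric])
      (intro integrable_continuous_real continuous_on_scaleR c1 c2 c Suc.prems | simp)+
  then have "integral {a..b} (\<lambda>t. ?\<phi>' t *\<^sub>R V m t) = - integral {a..b} (\<lambda>t. \<phi> t *\<^sub>R V (Suc m) t)"
    by (simp add: eq_neg_iff_add_eq_0 add.commute)
  moreover have "integral {a..b} (\<lambda>t. (deriv ^^ m) ?\<phi>' t *\<^sub>R V 0 t) =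
      (- 1) ^ m *\<^sub>R integral {a..b} (\<lambda>t. ?\<phi>' t *\<^sub>R V m t)"
    by (rule Suc.IH[OF _ c test_function_deriv[OF Suc.prems(3)]]) (use Suc.prems(1) in simp)
  ultimately show ?case unfolding funpow_Suc_right comp_apply by simp
qed simp

lemma tendsto_integral_scaleR_uniform_limit:
  fixes v :: "nat \<Rightarrow> real \<Rightarrow> 'a::banach"
  assumes u: "uniform_limit {a..b} v l sequentially" and c: "\<And>i. continuous_on {a..b} (v i)"
    and k: "continuous_on {a..b} k"
  shows "(\<lambda>i. integral {a..b} (\<lambda>t. k t *\<^sub>R v i t)) \<longlonglongrightarrow> integral {a..b} (\<lambda>t. k t *\<^sub>R l t)"
proof -
  have cl: "continuous_on {a..b} l"
    by (rule uniform_limit_theorem[OF _ u]) (use c in auto)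
  have "bounded (k ` {a..b})" "bounded (l ` {a..b})"
    using compact_continuous_image[OF k] compact_continuous_image[OF cl] compact_imp_bounded by auto
  then have "uniform_limit {a..b} (\<lambda>i t. k t *\<^sub>R v i t) (\<lambda>t. k t *\<^sub>R l t) sequentially"
    by (intro bounded_bilinear_bounded_uniform_limit_intros uniform_limit_const u)
  moreover have "continuous_on {a..b} (\<lambda>t. k t *\<^sub>R v i t)" for i by (intro continuous_intros k c)
  ultimately obtain I J where I: "\<And>i. ((\<lambda>t. k t *\<^sub>R v i t) has_integral I i) {a..b}"
    "((\<lambda>t. k t *\<^sub>R l t) has_integral J) {a..b}" "I \<longlonglongrightarrow> J"
    by (rule uniform_limit_integral) auto
  show ?thesis unfolding I(1)[THEN integral_unique] I(2)[THEN integral_unique] by (rule I(3))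
qed

text \<open>The integrated identity contains no derivative of the limit, so it survives. Only the
  two ends of the chain have to converge; the intermediate derivatives need not.\<close>

lemma has_weak_deriv_uniform_limit:
  fixes V :: "nat \<Rightarrow> nat \<Rightarrow> real \<Rightarrow> 'a::banach"
  assumes "a < b"
    and d: "\<And>i j t. j < m \<Longrightarrow> t \<in> {a..b} \<Longrightarrow> (V i j has_vector_derivative V i (Suc j) t) (at t within {a..b})"
    and c: "\<And>i. continuous_on {a..b} (V i m)"
    and v: "uniform_limit {a..b} (\<lambda>i. V i 0) v sequentially"
    and w: "uniform_limit {a..b} (\<lambda>i. V i m) w sequentially"
  shows "has_weak_deriv a b m v w"
proof -
  have c0: "continuous_on {a..b} (V i 0)" for i
  proof (cases m)
    case 0
    then show ?thesis using c by simp
  next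
    case (Suc _)
    show ?thesis by (rule has_vector_derivative_continuous_on[OF d]) (use Suc in auto)
  qed
  have cv: "continuous_on {a..b} v" by (rule uniform_limit_theorem[OF _ v]) (use c0 in auto)
  have cw: "continuous_on {a..b} w" by (rule uniform_limit_theorem[OF _ w]) (use c in auto)
  show ?thesis
    unfolding has_weak_deriv_def
  proof (intro conjI allI impI locally_integrable_continuous cv cw)
    fix \<phi> assume \<phi>: "test_function a b \<phi>"
    note t1 = test_function_continuous[OF \<phi>]
    note t2 = test_function_continuous[OF test_function_higher_deriv[OF \<phi>]]
    have "(\<lambda>i. (- 1) ^ m *\<^sub>R integral {a..b} (\<lambda>t. \<phi> t *\<^sub>R V i m t)) \<longlonglongrightarrow>
        (- 1) ^ m *\<^sub>R integral {a..b} (\<lambda>t. \<phi> t *\<^sub>R w t)"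
      by (intro tendsto_scaleR tendsto_const tendsto_integral_scaleR_uniform_limit w c t1)
    moreover have "(\<lambda>i. integral {a..b} (\<lambda>t. (deriv ^^ m) \<phi> t *\<^sub>R V i 0 t)) \<longlonglongrightarrow>
        integral {a..b} (\<lambda>t. (deriv ^^ m) \<phi> t *\<^sub>R v t)"
      by (intro tendsto_integral_scaleR_uniform_limit v c0 t2)
    moreover have "integral {a..b} (\<lambda>t. (deriv ^^ m) \<phi> t *\<^sub>R V i 0 t) =
        (- 1) ^ m *\<^sub>R integral {a..b} (\<lambda>t. \<phi> t *\<^sub>R V i m t)" for i
      by (rule integral_higher_deriv_test_function[OF \<open>a < b\<close> d c \<phi>])
    ultimately have "integral {a..b} (\<lambda>t. (deriv ^^ m) \<phi> t *\<^sub>R v t) =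
        (- 1) ^ m *\<^sub>R integral {a..b} (\<lambda>t. \<phi> t *\<^sub>R w t)"
      using LIMSEQ_unique by simp
    then show "banach_integral (lebesgue_on {a<..<b}) (\<lambda>t. (deriv ^^ m) \<phi> t *\<^sub>R v t) =
        (- 1) ^ m *\<^sub>R banach_integral (lebesgue_on {a<..<b}) (\<lambda>t. \<phi> t *\<^sub>R w t)"
      unfolding banach_integral_open_interval[OF continuous_on_scaleR[OF t1 cw]]
        banach_integral_open_interval[OF continuous_on_scaleR[OF t2 cv]] .
  qed
qed

section \<open>Convolution with regularised kernels\<close>

text \<open>With \<open>y = x\<^sup>2 / (x\<^sup>2 + \<delta>\<^sup>2)\<close>, the kernel equals \<open>x\<^bsup>-\<alpha>\<^esup> y\<^bsup>\<alpha>/2 + 1\<^esup>\<close> for \<open>x > 0\<close>; the power of \<open>y\<close> makes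
  it continuously differentiable across \<open>0\<close>.\<close>

definition kern :: "real \<Rightarrow> real \<Rightarrow> real \<Rightarrow> real" where
  "kern \<alpha> \<delta> x = x * max x 0 * (x\<^sup>2 + \<delta>\<^sup>2) powr (- (\<alpha> / 2 + 1))"

definition kern' :: "real \<Rightarrow> real \<Rightarrow> real \<Rightarrow> real" where
  "kern' \<alpha> \<delta> x = 2 * max x 0 * (x\<^sup>2 + \<delta>\<^sup>2) powr (- (\<alpha> / 2 + 1))
     - (\<alpha> + 2) * x\<^sup>2 * max x 0 * (x\<^sup>2 + \<delta>\<^sup>2) powr (- (\<alpha> / 2 + 1) - 1)"

text \<open>This is the square cut off at 0. Its derivative is continuous, which makes the cut-off
  in \<open>kern\<close> harmless.\<close>

lemma DERIV_mult_max_0: "((\<lambda>x::real. x * max x 0) has_real_derivative 2 * max x 0) (at x)"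
proof (cases x "0::real" rule: linorder_cases)
  case less
  have "((\<lambda>_. 0) has_real_derivative 0) (at x)" by simp
  then have "((\<lambda>x::real. x * max x 0) has_real_derivative 0) (at x)"
    by (rule has_field_derivative_transform_within_open[where S = "{..<0}"]) (use less in auto)
  then show ?thesis using less by simp
next
  case greater
  have "((\<lambda>x. x * x) has_real_derivative 2 * x) (at x)" by (auto intro!: derivative_eq_intros)
  then have "((\<lambda>x::real. x * max x 0) has_real_derivative 2 * x) (at x)"
    by (rule has_field_derivative_transform_within_open[where S = "{0<..}"]) (use greater in auto)
  then show ?thesis using greater by simp
next
  case equal
  have "((\<lambda>h::real. max h 0) \<longlongrightarrow> 0) (at 0)" by (rule tendsto_eq_intros refl | simp)+
  then have "((\<lambda>h::real. h * max h 0 / h) \<longlongrightarrow> 0) (at 0)"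
    by (elim Lim_transform_eventually[rotated 0]) (simp_all add: eventually_at_filter)
  then show ?thesis using equal by (simp add: has_field_derivative_iff)
qed

lemma kern_has_derivative:
  assumes "\<delta> > 0"
  shows "(kern \<alpha> \<delta> has_real_derivative kern' \<alpha> \<delta> x) (at x)"
proof -
  have pos: "x\<^sup>2 + \<delta>\<^sup>2 > 0" using assms by (simp add: add_nonneg_pos)
  have *: "((\<lambda>x. (x\<^sup>2 + \<delta>\<^sup>2) powr (- (\<alpha> / 2 + 1))) has_real_derivative
      (- (\<alpha> / 2 + 1) * (x\<^sup>2 + \<delta>\<^sup>2) powr (- (\<alpha> / 2 + 1) - 1)) * (2 * x)) (at x)"
    using pos by (auto intro!: derivative_eq_intros simp: sum_power2_gt_zero_iff algebra_simps)
  show ?thesis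
    unfolding kern_def[abs_def] kern'_def
    by (rule DERIV_cong[OF DERIV_mult[OF DERIV_mult_max_0 *]]) (simp add: algebra_simps power2_eq_square)
qed

lemma continuous_on_kern [continuous_intros]: "\<delta> > 0 \<Longrightarrow> continuous_on S (kern \<alpha> \<delta>)"
  using kern_has_derivative by (meson DERIV_continuous_on has_field_derivative_at_within)

lemma continuous_on_kern' [continuous_intros]: 
  assumes "\<delta> > 0" shows "continuous_on S (kern' \<alpha> \<delta>)"
proof -
  have "x\<^sup>2 + \<delta>\<^sup>2 \<noteq> 0" for x using assms by (simp add: add_nonneg_pos less_imp_neq[THEN not_sym])
  then show ?thesis unfolding kern'_def by (intro continuous_intros) auto
qed

lemma kern_nonpos [simp]: "x \<le> 0 \<Longrightarrow> kern \<alpha> \<delta> x = 0" "x \<le> 0 \<Longrightarrow> kern' \<alpha> \<delta> x = 0"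
  by (auto simp: kern_def kern'_def)

text \<open>For \<open>x > 0\<close>, put \<open>q = \<alpha> / 2 + 1\<close> and
  \<open>z = 1 - y\<close>. Then \<open>kern\<close> is \<open>x powr - \<alpha>\<close> times
  \<open>y powr q\<close>, and \<open>kern'\<close> is \<open>x powr (- \<alpha> - 1)\<close> times
  \<open>2 * y powr q - (\<alpha> + 2) * y powr (q + 1)\<close>, so all four claims are inequalities
  for \<open>y\<close> between 0 and 1. The constant 3 bounds \<open>\<alpha> + 2\<close>; the
  constants 2 and 5 = 2 + 3 come from \<open>1 - y powr q \<le> 2 * z\<close> and
  \<open>1 - y powr (q + 1) \<le> 3 * z\<close>. At \<open>x = 0\<close> all powers are 0 by
  convention.\<close>

lemma kern_bounds:
  fixes x :: real
  assumes "0 < \<alpha>" "\<alpha> < 1" and \<delta>: "\<delta> > 0" and x: "x \<ge> 0" and \<theta>: "0 < \<theta>" "\<theta> \<le> 1"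
  shows kern_le: "\<bar>kern \<alpha> \<delta> x\<bar> \<le> x powr - \<alpha>"
    and kern'_le: "\<bar>kern' \<alpha> \<delta> x\<bar> \<le> 3 * x powr (- \<alpha> - 1)"
    and kern_approx: "\<bar>kern \<alpha> \<delta> x - x powr - \<alpha>\<bar> \<le> 2 * \<delta> powr \<theta> * x powr - (\<alpha> + \<theta>)"
    and kern'_approx: "\<bar>kern' \<alpha> \<delta> x + \<alpha> * x powr (- \<alpha> - 1)\<bar> \<le> 5 * \<delta> powr \<theta> * x powr - (\<alpha> + 1 + \<theta>)"
proof -
  have "\<bar>kern \<alpha> \<delta> x\<bar> \<le> x powr - \<alpha> \<and> \<bar>kern' \<alpha> \<delta> x\<bar> \<le> 3 * x powr (- \<alpha> - 1) \<and>
    \<bar>kern \<alpha> \<delta> x - x powr - \<alpha>\<bar> \<le> 2 * \<delta> powr \<theta> * x powr - (\<alpha> + \<theta>) \<and>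
    \<bar>kern' \<alpha> \<delta> x + \<alpha> * x powr (- \<alpha> - 1)\<bar> \<le> 5 * \<delta> powr \<theta> * x powr - (\<alpha> + 1 + \<theta>)"
  proof (cases "x = 0")
    case False
    with x have x: "x > 0" by simp
    define S where "S = x\<^sup>2 + \<delta>\<^sup>2"
    define q where "q = \<alpha> / 2 + 1"
    define y where "y = x\<^sup>2 / S"
    define z where "z = \<delta>\<^sup>2 / S"
    have S: "S > 0" using x by (simp add: S_def add_pos_nonneg)
    have q: "1 \<le> q" "q \<le> 2" using assms by (auto simp: q_def)
    have yz: "y + z = 1" using S unfolding y_def z_def by (simp flip: add_divide_distrib S_def)
    then have z_eq: "z = 1 - y" by simp
    have z0: "z > 0" using S \<delta> by (simp add: z_def)
    have y0: "y > 0" "y \<le> 1" using S x yz z0 by (simp add: y_def, linarith)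
    \<comment> \<open>As \<open>z\<close> is at most 1 and at most the square of
      \<open>\<delta> / x\<close>, it is bounded by every power of that ratio with exponent between
      0 and 2. The free exponent \<theta> trades speed of convergence against singularity.\<close>
    have zle: "z \<le> (\<delta> / x) powr \<theta>"
    proof (cases "\<delta> \<ge> x")
      case True
      then have "1 \<le> (\<delta> / x) powr \<theta>" using x \<theta> by (intro ge_one_powr_ge_zero) auto
      then show ?thesis using yz y0 by linarith
    next
      case False
      have "z \<le> \<delta>\<^sup>2 / x\<^sup>2"
        using x S unfolding z_def S_def by (intro divide_left_mono mult_pos_pos) auto
      also have "\<dots> = (\<delta> / x) powr 2" using x \<delta> by (simp add: power_divide)
      also have "\<dots> \<le> (\<delta> / x) powr \<theta>" using x \<delta> \<theta> False by (intro powr_mono') auto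
      finally show ?thesis .
    qed
    have yq: "y powr q \<le> 1" "y powr (q + 1) \<le> 1" "y powr q \<ge> 0" "y powr (q + 1) \<ge> 0"
      using y0 q by (auto intro!: powr_le1)
    have "y powr q \<ge> y powr 2" using y0 q by (intro powr_mono') auto
    moreover have "y powr 2 = (1 - z)\<^sup>2" using y0 yz by (simp add: algebra_simps)
    moreover have "(1 - z)\<^sup>2 \<ge> 1 - 2 * z" by (simp add: power2_eq_square algebra_simps)
    ultimately have y1: "1 - y powr q \<le> 2 * z" by linarith
    have yy: "y powr (q + 1) = y * y powr q" using y0 by (simp add: powr_add)
    have y2: "y powr q - y powr (q + 1) \<le> z" 
    proof -
      have "y powr q - y powr (q + 1) = y powr q * z" using yz unfolding yy by (simp add: algebra_simps z_eq)
      also have "\<dots> \<le> 1 * z" using yq z0 by (intro mult_right_mono) auto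
      finally show ?thesis by simp
    qed
    have y3: "1 - y powr (q + 1) \<le> 3 * z" using y1 y2 by linarith
    have y4: "y powr (q + 1) \<le> y powr q" using y0 by (intro powr_mono') auto
    \<comment> \<open>Since \<open>y\<close> is \<open>x\<^sup>2 / S\<close>, this identity
      translates between powers of \<open>y\<close> and the defining expressions of the
      kernels.\<close>
    have pw: "x powr r * y powr s = x powr (r + 2 * s) * S powr - s" for r s
    proof -
      have "y powr s = (x powr 2) powr s / S powr s" using x S unfolding y_def by (simp add: powr_divide)
      then show ?thesis by (simp add: powr_powr powr_add powr_minus divide_inverse)
    qed
    have k: "kern \<alpha> \<delta> x = x powr - \<alpha> * y powr q"
    proof -
      have "x powr - \<alpha> * y powr q = x powr 2 * S powr - q" unfolding pw by (simp add: q_def)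
      then show ?thesis using x unfolding kern_def S_def q_def by (simp add: power2_eq_square)
    qed
    have k': "kern' \<alpha> \<delta> x = x powr (- \<alpha> - 1) * (2 * y powr q - (\<alpha> + 2) * y powr (q + 1))"
    proof -
      have "x powr (- \<alpha> - 1) * y powr q = x powr 1 * S powr - q" unfolding pw by (simp add: q_def)
      moreover have "x powr (- \<alpha> - 1) * y powr (q + 1) = x powr 3 * S powr (- q - 1)"
        unfolding pw by (simp add: q_def algebra_simps)
      moreover have "kern' \<alpha> \<delta> x = 2 * (x * S powr - q) - (\<alpha> + 2) * (x ^ 3 * S powr (- q - 1))"
        using x unfolding kern'_def S_def q_def by (simp add: power2_eq_square power3_eq_cube)
      ultimately show ?thesis using x by (simp add: right_diff_distrib mult.left_commute[of "x powr _"])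
    qed
    have P: "x powr - (r + \<theta>) * \<delta> powr \<theta> = x powr - r * (\<delta> / x) powr \<theta>" for r
      using x \<delta> by (simp add: powr_divide powr_add powr_diff powr_minus field_simps)
    have xp: "x powr r \<ge> 0" for r by simp
    have 1: "\<bar>kern \<alpha> \<delta> x\<bar> \<le> x powr - \<alpha> * 1"
      unfolding k abs_mult using yq by (intro mult_mono) auto
    have 2: "\<bar>kern' \<alpha> \<delta> x\<bar> \<le> x powr (- \<alpha> - 1) * 3"
    proof -
      have "(\<alpha> + 2) * y powr (q + 1) \<le> 3 * 1" using assms yq by (intro mult_mono) auto
      moreover have "(\<alpha> + 2) * y powr (q + 1) \<ge> 0" using assms by simp
      ultimately have "\<bar>2 * y powr q - (\<alpha> + 2) * y powr (q + 1)\<bar> \<le> 3" using yq by linarith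
      then show ?thesis unfolding k' abs_mult by (intro mult_mono) auto
    qed
    have 3: "\<bar>kern \<alpha> \<delta> x - x powr - \<alpha>\<bar> \<le> x powr - \<alpha> * (2 * (\<delta> / x) powr \<theta>)"
    proof -
      have "kern \<alpha> \<delta> x - x powr - \<alpha> = x powr - \<alpha> * (y powr q - 1)" unfolding k by (simp add: algebra_simps)
      moreover have "\<bar>y powr q - 1\<bar> \<le> 2 * (\<delta> / x) powr \<theta>" using yq y1 zle by linarith
      ultimately show ?thesis unfolding abs_mult by (simp add: mult_left_mono abs_mult)
    qed
    have 4: "\<bar>kern' \<alpha> \<delta> x + \<alpha> * x powr (- \<alpha> - 1)\<bar> \<le> x powr (- \<alpha> - 1) * (5 * (\<delta> / x) powr \<theta>)"
    proof -
      \<comment> \<open>At \<open>y = 1\<close> the second factor of \<open>kern'\<close> is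
        \<open>2 - (\<alpha> + 2) = - \<alpha>\<close>, so the sum consists of differences that are
        of order \<open>z\<close>.\<close>
      have "kern' \<alpha> \<delta> x + \<alpha> * x powr (- \<alpha> - 1) =
          x powr (- \<alpha> - 1) * (2 * (y powr q - y powr (q + 1)) + \<alpha> * (1 - y powr (q + 1)))"
        unfolding k' by (simp add: algebra_simps)
      moreover have "\<alpha> * (1 - y powr (q + 1)) \<le> 1 * (3 * z)" "\<alpha> * (1 - y powr (q + 1)) \<ge> 0"
        using assms y3 yq by (intro mult_mono mult_nonneg_nonneg; simp)+
      then have "\<bar>2 * (y powr q - y powr (q + 1)) + \<alpha> * (1 - y powr (q + 1))\<bar> \<le> 5 * (\<delta> / x) powr \<theta>"
      proof -
        have "\<bar>2 * A + U\<bar> \<le> 5 * e" if "U \<le> 1 * (3 * z)" "0 \<le> U" "A \<le> z" "0 \<le> A" "z \<le> e" for A U e :: real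
          using that by linarith
        from this[OF \<open>_ \<le> 1 * (3 * z)\<close> \<open>0 \<le> \<alpha> * (1 - y powr (q + 1))\<close> y2 _ zle] y4 show ?thesis by simp
      qed
      ultimately show ?thesis by (simp add: mult_left_mono abs_mult)
    qed
    show ?thesis using 1 2 3 4 P[of \<alpha>] P[of "\<alpha> + 1"] by (simp add: mult_ac)
  qed simp
  then show "\<bar>kern \<alpha> \<delta> x\<bar> \<le> x powr - \<alpha>" "\<bar>kern' \<alpha> \<delta> x\<bar> \<le> 3 * x powr (- \<alpha> - 1)"
    "\<bar>kern \<alpha> \<delta> x - x powr - \<alpha>\<bar> \<le> 2 * \<delta> powr \<theta> * x powr - (\<alpha> + \<theta>)"
    "\<bar>kern' \<alpha> \<delta> x + \<alpha> * x powr (- \<alpha> - 1)\<bar> \<le> 5 * \<delta> powr \<theta> * x powr - (\<alpha> + 1 + \<theta>)"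
    by blast+
qed

lemma has_integral_powr_reflected:
  fixes a t p :: real
  assumes "a \<le> t" "p < 1"
  shows "((\<lambda>s. (t - s) powr - p) has_integral (t - a) powr (1 - p) / (1 - p)) {a..t}"
proof -
  let ?F = "\<lambda>s. - ((t - s) powr (1 - p) / (1 - p))"
  have "((\<lambda>s. (t - s) powr - p) has_integral (?F t - ?F a)) {a..t}"
  \<comment> \<open>The integrand may be unbounded at \<open>t\<close>, but its antiderivative is
    continuous up to the end point.\<close>
  proof (rule fundamental_theorem_of_calculus_interior)
    show "continuous_on {a..t} ?F" using assms by (intro continuous_intros continuous_on_powr') auto
    fix s assume s: "s \<in> {a<..<t}"
    then have "((\<lambda>s. (t - s) powr (1 - p)) has_real_derivative ((1 - p) * (t - s) powr (1 - p - 1)) * (-1)) (at s)"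
      by (auto intro!: derivative_eq_intros)
    then have "(?F has_real_derivative (t - s) powr - p) (at s)"
      using assms s by (auto intro!: derivative_eq_intros)
    then show "(?F has_vector_derivative (t - s) powr - p) (at s)"
      by (rule has_real_derivative_iff_has_vector_derivative[THEN iffD1])
  qed (use assms in auto)
  then show ?thesis using assms by simp
qed

lemma integrable_powr_reflected:
  fixes a t p :: real
  assumes "p < 1"
  shows "integrable (lebesgue_on {a..t}) (\<lambda>s. (t - s) powr - p)"
proof (cases "a \<le> t")
  case True
  then have "(\<lambda>s. (t - s) powr - p) absolutely_integrable_on {a..t}"
    using has_integral_powr_reflected[OF True assms]
    by (intro nonnegative_absolutely_integrable_1) (auto simp: integrable_on_def)
  then show ?thesis by (intro absolutely_integrable_imp_integrable) auto
next
  case False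
  then have "space (lebesgue_on {a..t}) = {}" by (simp add: space_restrict_space)
  then have "integrable (lebesgue_on {a..t}) (\<lambda>s. (t - s) powr - p) =
    integrable (lebesgue_on {a..t}) (\<lambda>s. 0::real)" by (intro Bochner_Integration.integrable_cong) auto
  then show ?thesis by simp
qed


section \<open>Calculus of convolutions\<close>

text \<open>The interval of integration is fixed instead of ending at \<open>t\<close>. For kernels
  that vanish at nonpositive arguments this is the same integral, and its derivative in
  \<open>t\<close> has no contribution from a moving end point.\<close>

definition conv :: "real \<Rightarrow> real \<Rightarrow> (real \<Rightarrow> real) \<Rightarrow> (real \<Rightarrow> 'a::banach) \<Rightarrow> real \<Rightarrow> 'a" where
  "conv a b K g t = integral {a..b} (\<lambda>s. K (t - s) *\<^sub>R g s)"

lemma continuous_on_conv_integrand: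
  fixes g :: "real \<Rightarrow> 'a::real_normed_vector"
  assumes "continuous_on UNIV K" "continuous_on S g"
  shows "continuous_on S (\<lambda>s. K (t - s) *\<^sub>R g s)"
  by (intro continuous_on_scaleR continuous_on_compose2[OF assms(1)] continuous_intros assms(2)) auto

lemma conv_has_vector_derivative:
  fixes g :: "real \<Rightarrow> 'a::banach"
  assumes K: "\<And>x. (K has_real_derivative K' x) (at x)" and K': "continuous_on UNIV K'"
    and g: "continuous_on {a..b} g" and t: "t \<in> {a..b}"
  shows "(conv a b K g has_vector_derivative conv a b K' g t) (at t within {a..b})"
proof -
  have cK: "continuous_on UNIV K" using K by (meson DERIV_continuous_on)
  have "((\<lambda>t. integral (cbox a b) (\<lambda>s. K (t - s) *\<^sub>R g s)) has_vector_derivative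
      integral (cbox a b) (\<lambda>s. K' (t - s) *\<^sub>R g s)) (at t within {a..b})"
  proof (rule leibniz_rule_vector_derivative)
    fix x s :: real
    have "((\<lambda>x. K (x - s)) has_real_derivative K' (x - s) * 1) (at x within {a..b})"
      by (rule DERIV_chain'[where f = "\<lambda>x. x - s", OF _ K]) (auto intro!: derivative_eq_intros)
    then have "((\<lambda>x. K (x - s) *\<^sub>R g s) has_vector_derivative K (x - s) *\<^sub>R 0 + (K' (x - s) * 1) *\<^sub>R g s) (at x within {a..b})"
      by (rule has_vector_derivative_scaleR) simp
    then show "((\<lambda>x. K (x - s) *\<^sub>R g s) has_vector_derivative K' (x - s) *\<^sub>R g s) (at x within {a..b})"
      by simp
  next
    show "(\<lambda>s. K (x - s) *\<^sub>R g s) integrable_on cbox a b" for x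
      unfolding cbox_interval by (intro integrable_continuous_real continuous_on_conv_integrand cK g)
    show "continuous_on ({a..b} \<times> cbox a b) (\<lambda>(x, s). K' (x - s) *\<^sub>R g s)"
      unfolding split_beta cbox_interval
      by (intro continuous_on_scaleR continuous_on_compose2[OF K'] continuous_on_compose2[OF g] continuous_intros) auto
  qed (use t in auto)
  then show ?thesis unfolding conv_def[abs_def] cbox_interval .
qed

text \<open>Integration by parts in \<open>s\<close>: the boundary term at \<open>b\<close> vanishes
  because \<open>t - b \<le> 0\<close>, the one at \<open>a\<close> because \<open>G a = 0\<close>.
  This moves a derivative from the kernel to \<open>G\<close>.\<close>

lemma conv_derivative_eq:
  fixes G G' :: "real \<Rightarrow> 'a::banach"
  assumes K: "\<And>x. (K has_real_derivative K' x) (at x)" and K': "continuous_on UNIV K'"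
    and K0: "\<And>x. x \<le> 0 \<Longrightarrow> K x = 0"
    and G: "\<And>s. s \<in> {a..b} \<Longrightarrow> (G has_vector_derivative G' s) (at s within {a..b})"
    and G': "continuous_on {a..b} G'" and "G a = 0" and t: "t \<in> {a..b}"
  shows "conv a b K' G t = conv a b K G' t"
proof -
  have cK: "continuous_on UNIV K" using K by (meson DERIV_continuous_on)
  have cG: "continuous_on {a..b} G" by (rule has_vector_derivative_continuous_on[OF G])
  have "((\<lambda>s. K (t - s) *\<^sub>R G' s + (K' (t - s) * - 1) *\<^sub>R G s) has_integral
      K (t - b) *\<^sub>R G b - K (t - a) *\<^sub>R G a) {a..b}"
  proof (rule fundamental_theorem_of_calculus)
    fix s assume s: "s \<in> {a..b}"
    have "((\<lambda>s. K (t - s)) has_real_derivative K' (t - s) * - 1) (at s within {a..b})"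
      by (rule DERIV_chain'[where f = "\<lambda>s. t - s", OF _ K]) (auto intro!: derivative_eq_intros)
    then show "((\<lambda>s. K (t - s) *\<^sub>R G s) has_vector_derivative K (t - s) *\<^sub>R G' s + (K' (t - s) * - 1) *\<^sub>R G s) (at s within {a..b})"
      by (rule has_vector_derivative_scaleR[OF _ G[OF s]])
  qed (use t in auto)
  then have "integral {a..b} (\<lambda>s. K (t - s) *\<^sub>R G' s - K' (t - s) *\<^sub>R G s) = 0"
    using t K0[of "t - b"] \<open>G a = 0\<close> by (simp add: integral_unique)
  then show ?thesis
    unfolding conv_def
    by (subst (asm) integral_diff)
      (intro integrable_continuous_real continuous_on_conv_integrand cK K' cG G' | simp)+
qed

lemma conv_eq_integral_upto:
  fixes g :: "real \<Rightarrow> 'a::banach"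
  assumes K: "continuous_on UNIV K" and K0: "\<And>x. x \<le> 0 \<Longrightarrow> K x = 0"
    and g: "continuous_on {a..b} g" and t: "t \<in> {a..b}"
  shows "conv a b K g t = integral {a..t} (\<lambda>s. K (t - s) *\<^sub>R g s)"
proof -
  have "integral {a..t} (\<lambda>s. K (t - s) *\<^sub>R g s) + integral {t..b} (\<lambda>s. K (t - s) *\<^sub>R g s) = conv a b K g t"
    unfolding conv_def using t
    by (intro Henstock_Kurzweil_Integration.integral_combine integrable_continuous_real continuous_on_conv_integrand K g) auto
  moreover have "integral {t..b} (\<lambda>s. K (t - s) *\<^sub>R g s) = integral {t..b} (\<lambda>s. 0)"
    using K0 by (intro integral_cong) simp
  ultimately show ?thesis by simp
qed

lemma uniform_limit_conv_kern:
  fixes g :: "real \<Rightarrow> 'a::banach"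
  assumes \<alpha>: "0 < \<alpha>" "\<alpha> < 1" and \<delta>: "\<And>i. \<delta> i > 0" "\<delta> \<longlonglongrightarrow> 0" and g: "continuous_on {a..b} g"
  shows "uniform_limit {a..b} (\<lambda>i. conv a b (kern \<alpha> (\<delta> i)) g)
    (\<lambda>t. integral {a..t} (\<lambda>s. (t - s) powr - \<alpha> *\<^sub>R g s)) sequentially"
proof -
  \<comment> \<open>Half of the room below exponent 1: the error bound has the singularity
    \<open>\<alpha> + \<theta> = (1 + \<alpha>) / 2\<close>, which is still integrable. Boundedness
    of \<open>g\<close> suffices here, since the kernel itself is integrable.\<close>
  define \<theta> where "\<theta> = (1 - \<alpha>) / 2"
  have \<theta>: "0 < \<theta>" "\<theta> \<le> 1" "\<alpha> + \<theta> < 1" using \<alpha> by (auto simp: \<theta>_def field_simps)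
  have "compact (g ` {a..b})" using g by (intro compact_continuous_image) auto
  then obtain B where B: "B > 0" "\<And>s. s \<in> {a..b} \<Longrightarrow> norm (g s) \<le> B"
    using bounded_pos[of "g ` {a..b}"] compact_imp_bounded by auto
  define C where "C = 2 * B * (b - a) powr (1 - (\<alpha> + \<theta>)) / (1 - (\<alpha> + \<theta>))"
  have le: "norm (conv a b (kern \<alpha> (\<delta> i)) g t - integral {a..t} (\<lambda>s. (t - s) powr - \<alpha> *\<^sub>R g s)) \<le> C * \<delta> i powr \<theta>"
    if t: "t \<in> {a..b}" for i t
  proof -
    have gt: "continuous_on {a..t} g" by (rule continuous_on_subset[OF g]) (use t in auto)
    have I1: "(\<lambda>s. (t - s) powr - \<alpha> *\<^sub>R g s) integrable_on {a..t}"
      using banach_integral_closed_interval[OF integrable_powr_reflected[OF \<alpha>(2)] gt] by (rule has_integral_integrable)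
    have I2: "(\<lambda>s. kern \<alpha> (\<delta> i) (t - s) *\<^sub>R g s) integrable_on {a..t}"
      by (intro integrable_continuous_real continuous_on_conv_integrand gt continuous_on_kern \<delta>)
    have I3: "((\<lambda>s. 2 * B * \<delta> i powr \<theta> * (t - s) powr - (\<alpha> + \<theta>)) has_integral
        2 * B * \<delta> i powr \<theta> * ((t - a) powr (1 - (\<alpha> + \<theta>)) / (1 - (\<alpha> + \<theta>)))) {a..t}"
      by (intro has_integral_mult_right has_integral_powr_reflected) (use t \<theta> in auto)
    have "conv a b (kern \<alpha> (\<delta> i)) g t - integral {a..t} (\<lambda>s. (t - s) powr - \<alpha> *\<^sub>R g s)
       = integral {a..t} (\<lambda>s. kern \<alpha> (\<delta> i) (t - s) *\<^sub>R g s) - integral {a..t} (\<lambda>s. (t - s) powr - \<alpha> *\<^sub>R g s)"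
      by (simp add: conv_eq_integral_upto[OF continuous_on_kern[OF \<delta>(1)] kern_nonpos(1) g t])
    also have "\<dots> = integral {a..t} (\<lambda>s. kern \<alpha> (\<delta> i) (t - s) *\<^sub>R g s - (t - s) powr - \<alpha> *\<^sub>R g s)"
      by (rule integral_diff[OF I2 I1, symmetric])
    also have "norm \<dots> \<le> integral {a..t} (\<lambda>s. 2 * B * \<delta> i powr \<theta> * (t - s) powr - (\<alpha> + \<theta>))"
    proof (rule integral_norm_bound_integral[OF integrable_diff[OF I2 I1] has_integral_integrable[OF I3]])
      fix s assume s: "s \<in> {a..t}"
      have "norm (kern \<alpha> (\<delta> i) (t - s) *\<^sub>R g s - (t - s) powr - \<alpha> *\<^sub>R g s)
          = \<bar>kern \<alpha> (\<delta> i) (t - s) - (t - s) powr - \<alpha>\<bar> * norm (g s)"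
        by (simp flip: scaleR_diff_left)
      also have "\<dots> \<le> (2 * \<delta> i powr \<theta> * (t - s) powr - (\<alpha> + \<theta>)) * B"
        using s t by (intro mult_mono kern_approx \<alpha> \<delta> \<theta> B) auto
      finally show "norm (kern \<alpha> (\<delta> i) (t - s) *\<^sub>R g s - (t - s) powr - \<alpha> *\<^sub>R g s) \<le>
          2 * B * \<delta> i powr \<theta> * (t - s) powr - (\<alpha> + \<theta>)" by (simp add: mult_ac)
    qed
    also have "\<dots> = 2 * B * \<delta> i powr \<theta> * ((t - a) powr (1 - (\<alpha> + \<theta>)) / (1 - (\<alpha> + \<theta>)))"
      by (rule integral_unique[OF I3])
    also have "\<dots> \<le> 2 * B * \<delta> i powr \<theta> * ((b - a) powr (1 - (\<alpha> + \<theta>)) / (1 - (\<alpha> + \<theta>)))"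
      using t \<theta> B by (intro mult_left_mono divide_right_mono powr_mono2) auto
    finally show ?thesis by (simp add: C_def mult_ac)
  qed
  have "(\<lambda>i. C * \<delta> i powr \<theta>) \<longlonglongrightarrow> C * 0"
    by (intro tendsto_mult tendsto_const tendsto_zero_powrI[OF \<delta>(2)]) (use \<theta> \<delta> in \<open>auto intro!: always_eventually less_imp_le\<close>)
  then have *: "(\<lambda>i. C * \<delta> i powr \<theta>) \<longlonglongrightarrow> 0" by simp
  show ?thesis
  proof (rule uniform_limitI)
    fix e :: real assume "e > 0"
    then have "\<forall>\<^sub>F i in sequentially. C * \<delta> i powr \<theta> < e" by (rule order_tendstoD(2)[OF *])
    then show "\<forall>\<^sub>F i in sequentially. \<forall>t\<in>{a..b}. dist (conv a b (kern \<alpha> (\<delta> i)) g t)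
        (integral {a..t} (\<lambda>s. (t - s) powr - \<alpha> *\<^sub>R g s)) < e"
    proof eventually_elim
      case (elim i)
      show ?case
      proof
        fix t assume "t \<in> {a..b}"
        from le[OF this, of i] elim show "dist (conv a b (kern \<alpha> (\<delta> i)) g t)
            (integral {a..t} (\<lambda>s. (t - s) powr - \<alpha> *\<^sub>R g s)) < e" by (simp add: dist_norm)
      qed
    qed
  qed
qed

text \<open>Since \<open>\<integral>\<^sub>a\<^sup>t K'(t - s) ds = K (t - a)\<close>, subtracting \<open>h t\<close> under the integral brings the
  Hoelder condition into play. The boundary term is controlled by it as well because \<open>h a = 0\<close>.\<close>

lemma conv_derivative_holder_bound:
  fixes h :: "real \<Rightarrow> 'a::banach"
  assumes K: "\<And>x. (K has_real_derivative K' x) (at x)" and K': "continuous_on UNIV K'"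
    and K0: "\<And>x. x \<le> 0 \<Longrightarrow> K x = 0" "\<And>x. x \<le> 0 \<Longrightarrow> K' x = 0"
    and h: "continuous_on {a..b} h" "h a = 0"
    and hol: "\<And>s t. s \<in> {a..b} \<Longrightarrow> t \<in> {a..b} \<Longrightarrow> norm (h t - h s) \<le> C * \<bar>t - s\<bar> powr \<beta>"
    and "\<gamma> > 0" "P \<ge> 0" "Q \<ge> 0" "C \<ge> 0"
    and KP: "\<And>x. x \<ge> 0 \<Longrightarrow> \<bar>K x\<bar> \<le> P * x powr (\<gamma> - \<beta>)"
    and KQ: "\<And>x. x \<ge> 0 \<Longrightarrow> \<bar>K' x\<bar> \<le> Q * x powr (\<gamma> - \<beta> - 1)"
    and t: "t \<in> {a..b}"
  shows "norm (conv a b K' h t) \<le> C * ((P + Q / \<gamma>) * (b - a) powr \<gamma>)"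
proof -
  have ht: "continuous_on {a..t} h" by (rule continuous_on_subset[OF h(1)]) (use t in auto)
  have cK: "continuous_on UNIV K" using K by (meson DERIV_continuous_on)
  have cs: "continuous_on {a..t} (\<lambda>s. K' (t - s))"
    by (intro continuous_on_compose2[OF K'] continuous_intros) auto
  have "((\<lambda>s. K' (t - s)) has_integral (- K (t - t)) - (- K (t - a))) {a..t}"
  proof (rule fundamental_theorem_of_calculus)
    fix s assume "s \<in> {a..t}"
    have "((\<lambda>s. K (t - s)) has_real_derivative K' (t - s) * - 1) (at s within {a..t})"
      by (rule DERIV_chain'[where f = "\<lambda>s. t - s", OF _ K]) (auto intro!: derivative_eq_intros)
    from DERIV_minus[OF this] show "((\<lambda>s. - K (t - s)) has_vector_derivative K' (t - s)) (at s within {a..t})"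
      by (simp add: has_real_derivative_iff_has_vector_derivative)
  qed (use t in auto)
  then have IK: "((\<lambda>s. K' (t - s)) has_integral K (t - a)) {a..t}" using K0(1)[of 0] by simp
  have J: "(\<lambda>s. K' (t - s) *\<^sub>R (h t - h s)) integrable_on {a..t}"
    by (intro integrable_continuous_real continuous_on_scaleR cs continuous_intros ht)
  have "conv a b K' h t = integral {a..t} (\<lambda>s. K' (t - s) *\<^sub>R h s)"
    by (rule conv_eq_integral_upto[OF K' K0(2) h(1) t])
  also have "\<dots> = integral {a..t} (\<lambda>s. K' (t - s) *\<^sub>R h t - K' (t - s) *\<^sub>R (h t - h s))"
    by (simp add: scaleR_diff_right)
  also have "\<dots> = integral {a..t} (\<lambda>s. K' (t - s) *\<^sub>R h t) - integral {a..t} (\<lambda>s. K' (t - s) *\<^sub>R (h t - h s))"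
    by (rule integral_diff[OF has_integral_integrable[OF has_integral_scaleR_left[OF IK]] J])
  also have "integral {a..t} (\<lambda>s. K' (t - s) *\<^sub>R h t) = K (t - a) *\<^sub>R h t"
    by (rule integral_unique[OF has_integral_scaleR_left[OF IK]])
  finally have eq: "conv a b K' h t = K (t - a) *\<^sub>R h t - integral {a..t} (\<lambda>s. K' (t - s) *\<^sub>R (h t - h s))" .
  have pw: "x powr (\<gamma> - \<beta>) * x powr \<beta> \<le> x powr \<gamma>" "x powr (\<gamma> - \<beta> - 1) * x powr \<beta> = x powr - (1 - \<gamma>)" if "x \<ge> 0" for x
    by (simp_all flip: powr_add)
  have mono: "(t - a) powr \<gamma> \<le> (b - a) powr \<gamma>" using t \<open>\<gamma> > 0\<close> by (intro powr_mono2) auto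
  have "norm (K (t - a) *\<^sub>R h t) \<le> (P * (t - a) powr (\<gamma> - \<beta>)) * (C * (t - a) powr \<beta>)"
    unfolding norm_scaleR using hol[of a t] t \<open>h a = 0\<close> \<open>P \<ge> 0\<close>
    by (intro mult_mono KP) auto
  also have "\<dots> = C * P * ((t - a) powr (\<gamma> - \<beta>) * (t - a) powr \<beta>)" by simp
  also have "\<dots> \<le> C * P * (b - a) powr \<gamma>"
    using pw(1)[of "t - a"] mono t \<open>C \<ge> 0\<close> \<open>P \<ge> 0\<close> by (intro mult_left_mono) auto
  finally have 1: "norm (K (t - a) *\<^sub>R h t) \<le> C * P * (b - a) powr \<gamma>" .
  have I: "((\<lambda>s. C * Q * (t - s) powr - (1 - \<gamma>)) has_integral C * Q * ((t - a) powr (1 - (1 - \<gamma>)) / (1 - (1 - \<gamma>)))) {a..t}"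
    by (intro has_integral_mult_right has_integral_powr_reflected) (use t \<open>\<gamma> > 0\<close> in auto)
  have "norm (integral {a..t} (\<lambda>s. K' (t - s) *\<^sub>R (h t - h s))) \<le> integral {a..t} (\<lambda>s. C * Q * (t - s) powr - (1 - \<gamma>))"
  proof (rule integral_norm_bound_integral[OF J has_integral_integrable[OF I]])
    fix s assume s: "s \<in> {a..t}"
    have "norm (K' (t - s) *\<^sub>R (h t - h s)) \<le> (Q * (t - s) powr (\<gamma> - \<beta> - 1)) * (C * (t - s) powr \<beta>)"
      unfolding norm_scaleR using hol[of s t] t s \<open>Q \<ge> 0\<close> by (intro mult_mono KQ) auto
    also have "\<dots> = C * Q * ((t - s) powr (\<gamma> - \<beta> - 1) * (t - s) powr \<beta>)" by simp
    also have "\<dots> = C * Q * (t - s) powr - (1 - \<gamma>)" using pw(2)[of "t - s"] s by simp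
    finally show "norm (K' (t - s) *\<^sub>R (h t - h s)) \<le> C * Q * (t - s) powr - (1 - \<gamma>)" .
  qed
  also have "\<dots> = C * Q * ((t - a) powr \<gamma> / \<gamma>)" using integral_unique[OF I] by simp
  also have "\<dots> \<le> C * Q * ((b - a) powr \<gamma> / \<gamma>)"
    using mono \<open>C \<ge> 0\<close> \<open>Q \<ge> 0\<close> \<open>\<gamma> > 0\<close> by (intro mult_left_mono divide_right_mono) auto
  finally have 2: "norm (integral {a..t} (\<lambda>s. K' (t - s) *\<^sub>R (h t - h s))) \<le> C * Q * ((b - a) powr \<gamma> / \<gamma>)" .
  have "norm (conv a b K' h t) \<le> C * P * (b - a) powr \<gamma> + C * Q * ((b - a) powr \<gamma> / \<gamma>)"
    unfolding eq by (rule order_trans[OF norm_triangle_ineq4 add_mono[OF 1 2]])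
  also have "\<dots> = C * ((P + Q / \<gamma>) * (b - a) powr \<gamma>)" by (simp add: algebra_simps)
  finally show ?thesis .
qed

text \<open>The same Hoelder estimate is used twice: for one kernel it bounds the limit, for the
  difference of two kernels it gives the Cauchy property. The limit then exists by completeness, and
  no formula with the singular kernel \<open>x powr (- \<alpha> - 1)\<close> is required for
  it.\<close>

lemma conv_kern'_uniformly_convergent:
  fixes h :: "real \<Rightarrow> 'a::banach"
  assumes \<alpha>: "0 < \<alpha>" "\<alpha> < \<beta>" "\<beta> \<le> 1" and \<delta>: "\<And>i. \<delta> i > 0" "\<delta> \<longlonglongrightarrow> 0"
    and h: "continuous_on {a..b} h" "h a = 0"
    and hol: "\<And>s t. s \<in> {a..b} \<Longrightarrow> t \<in> {a..b} \<Longrightarrow> norm (h t - h s) \<le> C * \<bar>t - s\<bar> powr \<beta>" and "C \<ge> 0"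
  obtains w where "uniform_limit {a..b} (\<lambda>i. conv a b (kern' \<alpha> (\<delta> i)) h) w sequentially"
    "\<And>t. t \<in> {a..b} \<Longrightarrow> norm (w t) \<le> C * ((1 + 3 / (\<beta> - \<alpha>)) * (b - a) powr (\<beta> - \<alpha>))"
proof -
  \<comment> \<open>Half of the gap gives \<open>\<alpha> + \<theta> = \<beta> - \<theta>\<close>,
    so the approximation errors have exactly the exponents of the estimate with
    \<open>\<gamma> = \<theta>\<close>.\<close>
  define \<theta> where "\<theta> = (\<beta> - \<alpha>) / 2"
  have \<theta>: "0 < \<theta>" "\<theta> \<le> 1" and \<alpha>1: "\<alpha> < 1" using \<alpha> by (auto simp: \<theta>_def field_simps)
  have e1: "- (\<alpha> + \<theta>) = \<theta> - \<beta>" "- (\<alpha> + 1 + \<theta>) = \<theta> - \<beta> - 1" by (simp_all add: \<theta>_def field_simps)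
  let ?W = "\<lambda>i. conv a b (kern' \<alpha> (\<delta> i)) h"
  have bound: "norm (?W i t) \<le> C * ((1 + 3 / (\<beta> - \<alpha>)) * (b - a) powr (\<beta> - \<alpha>))" if t: "t \<in> {a..b}" for i t
  proof (rule conv_derivative_holder_bound[OF kern_has_derivative[OF \<delta>(1)] continuous_on_kern'[OF \<delta>(1)] _ _ h hol])
    \<comment> \<open>Here \<open>\<gamma> = \<beta> - \<alpha>\<close>, \<open>P = 1\<close> and
      \<open>Q = 3\<close>, which explains the factor
      \<open>1 + 3 / (\<beta> - \<alpha>)\<close>.\<close>
    show "\<bar>kern \<alpha> (\<delta> i) x\<bar> \<le> 1 * x powr (\<beta> - \<alpha> - \<beta>)" if "x \<ge> 0" for x
      using kern_le[OF \<alpha>(1) \<alpha>1 \<delta>(1) that \<theta>] by simp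
    show "\<bar>kern' \<alpha> (\<delta> i) x\<bar> \<le> 3 * x powr (\<beta> - \<alpha> - \<beta> - 1)" if "x \<ge> 0" for x
      using kern'_le[OF \<alpha>(1) \<alpha>1 \<delta>(1) that \<theta>] by simp
  qed (use \<open>C \<ge> 0\<close> \<alpha> t in auto)
  define A where "A = C * ((2 + 5 / \<theta>) * (b - a) powr \<theta>)"
  have diff: "norm (?W i t - ?W j t) \<le> A * (\<delta> i powr \<theta> + \<delta> j powr \<theta>)" if t: "t \<in> {a..b}" for i j t
  proof -
    define D where "D = \<delta> i powr \<theta> + \<delta> j powr \<theta>"
    \<comment> \<open>Both kernels are compared with the same singular one, which cancels in the
      difference and leaves \<open>P = 2 * D\<close> and \<open>Q = 5 * D\<close>.\<close>
    let ?K = "\<lambda>x. kern \<alpha> (\<delta> i) x - kern \<alpha> (\<delta> j) x" and ?K' = "\<lambda>x. kern' \<alpha> (\<delta> i) x - kern' \<alpha> (\<delta> j) x"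
    have "norm (conv a b ?K' h t) \<le> C * ((2 * D + (5 * D) / \<theta>) * (b - a) powr \<theta>)"
    proof (rule conv_derivative_holder_bound[where K = ?K, OF _ _ _ _ h hol])
      show "(?K has_real_derivative ?K' x) (at x)" for x
        by (intro DERIV_diff kern_has_derivative \<delta>)
      show "continuous_on UNIV ?K'" by (intro continuous_intros \<delta>)
      show "\<bar>?K x\<bar> \<le> 2 * D * x powr (\<theta> - \<beta>)" if "x \<ge> 0" for x
        using kern_approx[OF \<alpha>(1) \<alpha>1 \<delta>(1)[of i] that \<theta>] kern_approx[OF \<alpha>(1) \<alpha>1 \<delta>(1)[of j] that \<theta>]
        unfolding e1 D_def by (simp add: distrib_left distrib_right)
      show "\<bar>?K' x\<bar> \<le> 5 * D * x powr (\<theta> - \<beta> - 1)" if "x \<ge> 0" for x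
        using kern'_approx[OF \<alpha>(1) \<alpha>1 \<delta>(1)[of i] that \<theta>] kern'_approx[OF \<alpha>(1) \<alpha>1 \<delta>(1)[of j] that \<theta>]
        unfolding e1 D_def by (simp add: distrib_left distrib_right)
    qed (use \<open>C \<ge> 0\<close> \<theta> t in \<open>auto simp: D_def\<close>)
    moreover have "conv a b ?K' h t = ?W i t - ?W j t"
      unfolding conv_def scaleR_diff_left
      by (rule integral_diff; intro integrable_continuous_real continuous_on_conv_integrand continuous_on_kern' \<delta> h)
    ultimately show ?thesis by (simp add: A_def D_def algebra_simps)
  qed
  have A: "A \<ge> 0" using \<open>C \<ge> 0\<close> \<theta> by (simp add: A_def)
  have "(\<lambda>i. A * \<delta> i powr \<theta>) \<longlonglongrightarrow> A * 0"
    by (intro tendsto_mult tendsto_const tendsto_zero_powrI[OF \<delta>(2)]) (use \<theta> \<delta> in \<open>auto intro!: always_eventually less_imp_le\<close>)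
  then have *: "(\<lambda>i. A * \<delta> i powr \<theta>) \<longlonglongrightarrow> 0" by simp
  have "uniformly_Cauchy_on {a..b} ?W"
    unfolding uniformly_Cauchy_on_def
  proof (intro allI impI)
    fix e :: real assume "e > 0"
    then have "\<forall>\<^sub>F i in sequentially. A * \<delta> i powr \<theta> < e / 2" by (intro order_tendstoD(2)[OF *]) simp
    then obtain N where N: "\<And>i. i \<ge> N \<Longrightarrow> A * \<delta> i powr \<theta> < e / 2" by (auto simp: eventually_sequentially)
    have "dist (?W i t) (?W j t) < e" if "t \<in> {a..b}" "i \<ge> N" "j \<ge> N" for t i j
      using diff[OF that(1), of i j] N[OF that(2)] N[OF that(3)] by (simp add: dist_norm distrib_left)
    then show "\<exists>M. \<forall>t\<in>{a..b}. \<forall>m\<ge>M. \<forall>n\<ge>M. dist (?W m t) (?W n t) < e" by blast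
  qed
  then obtain w where w: "uniform_limit {a..b} ?W w sequentially"
    using Cauchy_uniformly_convergent unfolding uniformly_convergent_on_def by blast
  have "norm (w t) \<le> C * ((1 + 3 / (\<beta> - \<alpha>)) * (b - a) powr (\<beta> - \<alpha>))" if "t \<in> {a..b}" for t
    by (rule Lim_norm_ubound[OF _ tendsto_uniform_limitI[OF w that]]) (use bound[OF that] in auto)
  with w show thesis by (rule that)
qed

section \<open>Hoelder and Caputo spaces\<close>

lemma ivl_deriv_0 [simp]: "ivl_deriv a b 0 f = f"
  by (simp add: ivl_deriv_def)

lemma ivl_deriv_Suc: "ivl_deriv a b (Suc k) f t = vector_derivative (ivl_deriv a b k f) (at t within {a..b})"
  by (simp add: ivl_deriv_def)

lemma Ck_has_vector_derivative:
  assumes "f \<in> Ck a b n" "j < n" "t \<in> {a..b}"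
  shows "(ivl_deriv a b j f has_vector_derivative ivl_deriv a b (Suc j) f t) (at t within {a..b})"
  using assms unfolding Ck_def differentiable_on_def ivl_deriv_Suc
  by (simp add: vector_derivative_works[symmetric])

text \<open>Passage from explicit formulas to the iterated \<open>ivl_deriv\<close>. As
  \<open>a < b\<close>, derivatives within the interval are unique, also at the end points.\<close>

lemma ivl_deriv_eqI:
  fixes F :: "nat \<Rightarrow> real \<Rightarrow> 'a::banach"
  assumes "a < b"
    and F: "\<And>j t. j < n \<Longrightarrow> t \<in> {a..b} \<Longrightarrow> (F j has_vector_derivative F (Suc j) t) (at t within {a..b})"
    and "continuous_on {a..b} (F n)"
  shows ivl_deriv_eq: "\<And>j t. j \<le> n \<Longrightarrow> t \<in> {a..b} \<Longrightarrow> ivl_deriv a b j (F 0) t = F j t"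
    and mem_Ck: "F 0 \<in> Ck a b n"
proof -
  have eq: "\<forall>t\<in>{a..b}. ivl_deriv a b j (F 0) t = F j t" if "j \<le> n" for j
    using that
  proof (induction j)
    case (Suc j)
    show ?case
    proof
      fix t assume t: "t \<in> {a..b}"
      have "(ivl_deriv a b j (F 0) has_vector_derivative F (Suc j) t) (at t within {a..b})"
        by (rule has_vector_derivative_transform[OF t _ F[OF _ t]]) (use Suc in auto)
      then show "ivl_deriv a b (Suc j) (F 0) t = F (Suc j) t"
        unfolding ivl_deriv_Suc using \<open>a < b\<close> t
        by (intro vector_derivative_within_cbox[where a = a and b = b, unfolded cbox_interval]) auto
    qed
  qed simp
  then show "\<And>j t. j \<le> n \<Longrightarrow> t \<in> {a..b} \<Longrightarrow> ivl_deriv a b j (F 0) t = F j t" by blast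
  have d: "(ivl_deriv a b j (F 0) has_vector_derivative F (Suc j) t) (at t within {a..b})"
    if "j < n" "t \<in> {a..b}" for j t
    by (rule has_vector_derivative_transform[OF that(2) _ F[OF that]]) (use eq[of j] that in auto)
  have "ivl_deriv a b j (F 0) differentiable_on {a..b}" if "j < n" for j
    using d[OF that] unfolding differentiable_on_def differentiable_def has_vector_derivative_def by blast
  moreover have "continuous_on {a..b} (ivl_deriv a b j (F 0))" if "j \<le> n" for j
  proof (cases "j < n")
    case True
    show ?thesis by (rule has_vector_derivative_continuous_on[OF d[OF True]])
  next
    case False
    then have "j = n" using that by simp
    have "continuous_on {a..b} (ivl_deriv a b n (F 0)) = continuous_on {a..b} (F n)"
      by (rule continuous_on_cong) (use eq[of n] in auto)
    then show ?thesis using assms(3) \<open>j = n\<close> by simp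
  qed
  ultimately show "F 0 \<in> Ck a b n" unfolding Ck_def by simp
qed

text \<open>\<open>taylor_rest a b n f j\<close> is the \<open>j\<close>-th derivative of \<open>f\<close> minus its Taylor polynomial of degree \<open>n\<close>
  at \<open>a\<close>; it is meant for \<open>j \<le> n\<close> only.\<close>

definition taylor_rest :: "real \<Rightarrow> real \<Rightarrow> nat \<Rightarrow> (real \<Rightarrow> 'a::banach) \<Rightarrow> nat \<Rightarrow> real \<Rightarrow> 'a" where
  "taylor_rest a b n f j t = ivl_deriv a b j f t -
     (\<Sum>i<Suc (n - j). ((t - a) ^ i / fact i) *\<^sub>R ivl_deriv a b (i + j) f a)"

lemma taylor_rest_at_base [simp]: "taylor_rest a b n f j a = 0"
  unfolding taylor_rest_def sum.lessThan_Suc_shift by simp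

lemma taylor_rest_last: "taylor_rest a b n f n t = ivl_deriv a b n f t - ivl_deriv a b n f a"
  by (simp add: taylor_rest_def)

lemma taylor_rest_has_vector_derivative:
  assumes "f \<in> Ck a b n" "j < n" "t \<in> {a..b}"
  shows "(taylor_rest a b n f j has_vector_derivative taylor_rest a b n f (Suc j) t) (at t within {a..b})"
proof -
  have nj: "n - j = Suc (n - Suc j)" using assms by simp
  have p: "((\<lambda>t. (t - a) ^ Suc i / fact (Suc i)) has_real_derivative (t - a) ^ i / fact i) (at t within {a..b})" for i
  proof -
    have "((\<lambda>t. (t - a) ^ Suc i / fact (Suc i)) has_real_derivative
        real (Suc i) * (t - a) ^ i / fact (Suc i)) (at t within {a..b})"
      by (auto intro!: derivative_eq_intros simp del: fact_Suc of_nat_Suc power_Suc)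
    moreover have "real (Suc i) * (t - a) ^ i / fact (Suc i) = (t - a) ^ i / fact i"
      by (simp add: divide_simps del: of_nat_Suc)
    ultimately show ?thesis by simp
  qed
  have q: "((\<lambda>t. ((t - a) ^ Suc i / fact (Suc i)) *\<^sub>R c) has_vector_derivative ((t - a) ^ i / fact i) *\<^sub>R c)
      (at t within {a..b})" for i and c :: 'a
    using has_vector_derivative_scaleR[OF p has_vector_derivative_const[of c]] by simp
  have "((\<lambda>t. ivl_deriv a b j f t - (ivl_deriv a b (0 + j) f a +
       (\<Sum>i<Suc (n - Suc j). ((t - a) ^ Suc i / fact (Suc i)) *\<^sub>R ivl_deriv a b (Suc i + j) f a)))
     has_vector_derivative ivl_deriv a b (Suc j) f t - (0 +
       (\<Sum>i<Suc (n - Suc j). ((t - a) ^ i / fact i) *\<^sub>R ivl_deriv a b (Suc i + j) f a))) (at t within {a..b})"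
    by (rule has_vector_derivative_diff[OF Ck_has_vector_derivative[OF assms]
          has_vector_derivative_add[OF has_vector_derivative_const has_vector_derivative_sum[OF q]]])
  then show ?thesis
    unfolding taylor_rest_def[abs_def] nj sum.lessThan_Suc_shift[of _ "Suc (n - Suc j)"] by simp
qed

lemma continuous_on_taylor_rest:
  assumes "f \<in> Ck a b n" "j \<le> n"
  shows "continuous_on {a..b} (taylor_rest a b n f j)"
  unfolding taylor_rest_def[abs_def] using assms by (intro continuous_intros) (auto simp: Ck_def)

lemma ceiling_nat_plus_frac:
  fixes \<alpha> :: real
  assumes "0 < \<alpha>" "\<alpha> \<le> 1"
  shows "\<lceil>real n + \<alpha>\<rceil> = int n + 1"
  using assms by (simp add: ceiling_eq_iff)

lemma nat_ceiling_nat_plus_frac: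
  fixes \<alpha> :: real
  assumes "0 < \<alpha>" "\<alpha> \<le> 1"
  shows "nat \<lceil>real n + \<alpha>\<rceil> = Suc n"
  unfolding ceiling_nat_plus_frac[OF assms] by simp

lemma rl_integral_eq:
  fixes g :: "real \<Rightarrow> 'a::banach"
  assumes "\<alpha> < 1" "continuous_on {a..b} g" "t \<in> {a..b}"
  shows "rl_integral a (1 - \<alpha>) g t = (1 / Gamma (1 - \<alpha>)) *\<^sub>R integral {a..t} (\<lambda>s. (t - s) powr - \<alpha> *\<^sub>R g s)"
proof -
  have "continuous_on {a..t} g" by (rule continuous_on_subset[OF assms(2)]) (use assms(3) in auto)
  from integral_unique[OF banach_integral_closed_interval[OF integrable_powr_reflected[OF assms(1)] this]]
  show ?thesis using assms(1) by (simp add: rl_integral_def)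
qed

text \<open>The ceiling of \<open>n + \<alpha>\<close> is \<open>n + 1\<close>, so the sum in the
  Caputo derivative stops at degree \<open>n\<close> and is the polynomial subtracted in
  \<open>taylor_rest\<close>.\<close>

lemma has_caputo_deriv_iff:
  fixes f :: "real \<Rightarrow> 'a::banach"
  assumes "0 < \<alpha>" "\<alpha> < 1"
  shows "has_caputo_deriv a b (real n + \<alpha>) f w \<longleftrightarrow>
    has_weak_deriv a b (Suc n) (rl_integral a (1 - \<alpha>) (taylor_rest a b n f 0)) w"
proof -
  have "of_int \<lceil>real n + \<alpha>\<rceil> - (real n + \<alpha>) = 1 - \<alpha>"
    using ceiling_nat_plus_frac[of \<alpha> n] assms by simp
  then show ?thesis
    unfolding has_caputo_deriv_def has_rl_deriv_def nat_ceiling_nat_plus_frac[OF assms(1) less_imp_le[OF assms(2)]] \<open>_ = 1 - \<alpha>\<close>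
    by (simp add: taylor_rest_def[abs_def] del: sum.lessThan_Suc)
qed

section \<open>Hoelder functions have a continuous Caputo derivative\<close>

lemma holder_imp_has_caputo_deriv:
  fixes f :: "real \<Rightarrow> 'a::banach"
  assumes "a < b" and \<alpha>: "0 < \<alpha>" "\<alpha> < \<beta>" "\<beta> \<le> 1" and f: "f \<in> Ck a b n" and C: "C \<ge> 0"
    and hol: "\<And>s t. s \<in> {a..b} \<Longrightarrow> t \<in> {a..b} \<Longrightarrow>
      norm (ivl_deriv a b n f t - ivl_deriv a b n f s) \<le> C * \<bar>t - s\<bar> powr \<beta>"
  obtains w where "continuous_on {a..b} w" "has_caputo_deriv a b (real n + \<alpha>) f w"
    "\<And>t. t \<in> {a..b} \<Longrightarrow> norm (w t) \<le> C * ((1 + 3 / (\<beta> - \<alpha>)) * (b - a) powr (\<beta> - \<alpha>) / Gamma (1 - \<alpha>))"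
proof -
  have \<alpha>1: "\<alpha> < 1" using \<alpha> by simp
  define \<delta> where "\<delta> i = 1 / real (Suc i)" for i
  have \<delta>: "\<And>i. \<delta> i > 0" "\<delta> \<longlonglongrightarrow> 0"
    unfolding \<delta>_def using LIMSEQ_Suc[OF lim_1_over_n] by auto
  let ?G = "taylor_rest a b n f"
  let ?c = "1 / Gamma (1 - \<alpha>)"
  have \<Gamma>: "Gamma (1 - \<alpha>) > 0" using \<alpha>1 by (intro Gamma_real_pos) simp
  note cG = continuous_on_taylor_rest[OF f]
  have "norm (?G n t - ?G n s) \<le> C * \<bar>t - s\<bar> powr \<beta>" if "s \<in> {a..b}" "t \<in> {a..b}" for s t
    using hol[OF that] by (simp add: taylor_rest_last)
  then obtain w where w: "uniform_limit {a..b} (\<lambda>i. conv a b (kern' \<alpha> (\<delta> i)) (?G n)) w sequentially"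
    "\<And>t. t \<in> {a..b} \<Longrightarrow> norm (w t) \<le> C * ((1 + 3 / (\<beta> - \<alpha>)) * (b - a) powr (\<beta> - \<alpha>))"
    using conv_kern'_uniformly_convergent[OF \<alpha> \<delta> cG[OF order_refl] taylor_rest_at_base _ C] by blast
  \<comment> \<open>The chain of derivatives for the \<open>i\<close>-th kernel. Up to order
    \<open>n\<close> they fall on the Taylor rest; its \<open>n\<close>-th derivative is merely
    Hoelder continuous, so the last differentiation has to hit the kernel.\<close>
  define V where "V i j = (\<lambda>t. ?c *\<^sub>R (if j \<le> n then conv a b (kern \<alpha> (\<delta> i)) (?G j) t
      else conv a b (kern' \<alpha> (\<delta> i)) (?G n) t))" for i j
  have d: "(conv a b (kern \<alpha> (\<delta> i)) (?G j) has_vector_derivative conv a b (kern' \<alpha> (\<delta> i)) (?G j) t)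
      (at t within {a..b})" if "j \<le> n" "t \<in> {a..b}" for i j t
    by (rule conv_has_vector_derivative[OF kern_has_derivative[OF \<delta>(1)] continuous_on_kern'[OF \<delta>(1)] cG[OF that(1)] that(2)])
  have scaled: "((\<lambda>t. c *\<^sub>R F t) has_vector_derivative c *\<^sub>R D) (at t within S)"
    if "(F has_vector_derivative D) (at t within S)" for c t S and F :: "real \<Rightarrow> 'a" and D
    by (rule bounded_linear.has_vector_derivative[OF bounded_linear_scaleR_right that])
  have dV: "(V i j has_vector_derivative V i (Suc j) t) (at t within {a..b})"
    if j: "j < Suc n" and t: "t \<in> {a..b}" for i j t
  proof (cases "j = n")
    case True
    then show ?thesis unfolding V_def using scaled[OF d[of n, OF _ t]] by simp
  next
    case False
    then have jn: "j < n" using j by simp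
    have "conv a b (kern' \<alpha> (\<delta> i)) (?G j) t = conv a b (kern \<alpha> (\<delta> i)) (?G (Suc j)) t"
      by (rule conv_derivative_eq[OF kern_has_derivative[OF \<delta>(1)] continuous_on_kern'[OF \<delta>(1)] kern_nonpos(1)
            taylor_rest_has_vector_derivative[OF f jn] _ taylor_rest_at_base t])
        (use jn in \<open>auto intro: cG\<close>)
    then show ?thesis unfolding V_def using scaled[OF d[of j _ i, OF _ t], of ?c] jn by simp
  qed
  have cV: "continuous_on {a..b} (V i (Suc n))" for i
  proof -
    have "continuous_on ({a..b} \<times> cbox a b) (\<lambda>(t, s). kern' \<alpha> (\<delta> i) (t - s) *\<^sub>R ?G n s)"
      unfolding split_beta cbox_interval
      by (intro continuous_on_scaleR continuous_on_compose2[OF continuous_on_kern'[OF \<delta>(1), of UNIV]]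
          continuous_on_compose2[OF cG[OF order_refl]] continuous_intros) auto
    then have "continuous_on {a..b} (conv a b (kern' \<alpha> (\<delta> i)) (?G n))"
      unfolding conv_def[abs_def] using integral_continuous_on_param[of "{a..b}" a b] by (simp add: cbox_interval)
    then show ?thesis unfolding V_def by (intro continuous_intros) simp
  qed
  have limV: "uniform_limit {a..b} (\<lambda>i. V i 0) (rl_integral a (1 - \<alpha>) (?G 0)) sequentially"
  proof -
    have "uniform_limit {a..b} (\<lambda>i t. ?c *\<^sub>R conv a b (kern \<alpha> (\<delta> i)) (?G 0) t)
        (\<lambda>t. ?c *\<^sub>R integral {a..t} (\<lambda>s. (t - s) powr - \<alpha> *\<^sub>R ?G 0 s)) sequentially"
      by (intro bounded_linear.uniform_limit[OF bounded_linear_scaleR_right] uniform_limit_conv_kern \<alpha> \<alpha>1 \<delta> cG) simp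
    moreover have "?c *\<^sub>R integral {a..t} (\<lambda>s. (t - s) powr - \<alpha> *\<^sub>R ?G 0 s) = rl_integral a (1 - \<alpha>) (?G 0) t"
      if "t \<in> {a..b}" for t
      using rl_integral_eq[OF \<alpha>1 cG[of 0] that] by simp
    ultimately show ?thesis
      by (subst (asm) uniform_limit_cong'[where g = "\<lambda>i. V i 0" and i = "rl_integral a (1 - \<alpha>) (?G 0)"])
        (simp_all add: V_def)
  qed
  have limW: "uniform_limit {a..b} (\<lambda>i. V i (Suc n)) (\<lambda>t. ?c *\<^sub>R w t) sequentially"
    unfolding V_def by simp (rule bounded_linear.uniform_limit[OF bounded_linear_scaleR_right w(1)])
  show thesis
  proof (rule that)
    show "continuous_on {a..b} (\<lambda>t. ?c *\<^sub>R w t)"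
      by (rule uniform_limit_theorem[OF _ limW]) (use cV in auto)
    show "has_caputo_deriv a b (real n + \<alpha>) f (\<lambda>t. ?c *\<^sub>R w t)"
      unfolding has_caputo_deriv_iff[OF \<alpha>(1) \<alpha>1]
      by (rule has_weak_deriv_uniform_limit[OF \<open>a < b\<close> dV cV limV limW])
    fix t assume "t \<in> {a..b}"
    from w(2)[OF this] show "norm (?c *\<^sub>R w t) \<le> C * ((1 + 3 / (\<beta> - \<alpha>)) * (b - a) powr (\<beta> - \<alpha>) / Gamma (1 - \<alpha>))"
      using \<Gamma> by (simp add: divide_right_mono)
  qed
qed

text \<open>By uniqueness, the choice behind \<open>SOME\<close> is immaterial: any continuous weak
  derivative that has been constructed may be used to compute the norm.\<close>

lemma caputo_deriv_eq:
  fixes f :: "real \<Rightarrow> 'a::banach"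
  assumes "a < b" "continuous_on {a..b} w" "has_caputo_deriv a b \<gamma> f w" "t \<in> {a..b}"
  shows "caputo_deriv a b \<gamma> f t = w t"
proof -
  have *: "continuous_on {a..b} (caputo_deriv a b \<gamma> f) \<and> has_caputo_deriv a b \<gamma> f (caputo_deriv a b \<gamma> f)"
    unfolding caputo_deriv_def
    by (rule someI[where P = "\<lambda>w. continuous_on {a..b} w \<and> has_caputo_deriv a b \<gamma> f w" and x = w])
      (use assms(2,3) in simp)
  show ?thesis
    by (rule has_weak_deriv_unique[OF assms(1) *[THEN conjunct2, unfolded has_caputo_deriv_def has_rl_deriv_def]
          assms(3)[unfolded has_caputo_deriv_def has_rl_deriv_def] *[THEN conjunct1] assms(2,4)])
qed

lemma sup_norm_nonneg:
  fixes g :: "real \<Rightarrow> 'a::banach"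
  assumes "a \<le> b" "continuous_on {a..b} g"
  shows "sup_norm a b g \<ge> 0"
proof -
  have "bdd_above ((\<lambda>t. norm (g t)) ` {a..b})"
    using assms by (intro bounded_imp_bdd_above compact_imp_bounded compact_continuous_image continuous_intros) auto
  then have "norm (g a) \<le> sup_norm a b g" unfolding sup_norm_def using assms(1) by (intro cSUP_upper) auto
  then show ?thesis using norm_ge_zero order_trans by blast
qed

lemma Ck_norm_nonneg:
  fixes f :: "real \<Rightarrow> 'a::banach"
  assumes "a \<le> b" "f \<in> Ck a b n"
  shows "Ck_norm a b n f \<ge> 0"
  unfolding Ck_norm_def using assms by (intro sum_nonneg sup_norm_nonneg) (auto simp: Ck_def)

text \<open>\<open>C\<close> is the supremum in the Hoelder norm. The Hoelder condition bounds the
  quotients, without which \<open>SUP\<close> would say nothing, and \<open>a < b\<close> supplies a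
  pair of distinct points.\<close>

lemma holder_seminorm_bound:
  fixes f :: "real \<Rightarrow> 'a::banach"
  assumes "a < b" "f \<in> holder_space a b n \<beta>"
  defines "C \<equiv> holder_norm a b n \<beta> f - Ck_norm a b n f"
  shows "C \<ge> 0"
    and "s \<in> {a..b} \<Longrightarrow> t \<in> {a..b} \<Longrightarrow>
      norm (ivl_deriv a b n f t - ivl_deriv a b n f s) \<le> C * \<bar>t - s\<bar> powr \<beta>"
proof -
  let ?g = "ivl_deriv a b n f"
  let ?A = "{(t, s). t \<in> {a..b} \<and> s \<in> {a..b} \<and> t \<noteq> s}"
  let ?q = "\<lambda>(t, s). norm (?g t - ?g s) / \<bar>t - s\<bar> powr \<beta>"
  obtain M where M: "\<And>t s. t \<in> {a..b} \<Longrightarrow> s \<in> {a..b} \<Longrightarrow> norm (?g t - ?g s) \<le> M * \<bar>t - s\<bar> powr \<beta>"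
    using assms(2) unfolding holder_space_def by blast
  have C: "C = (SUP p\<in>?A. ?q p)" unfolding C_def holder_norm_def by simp
  have "bdd_above (?q ` ?A)"
  proof (rule bdd_aboveI2)
    fix p assume "p \<in> ?A"
    then obtain t s where p: "p = (t, s)" and ts: "t \<in> {a..b}" "s \<in> {a..b}" "t \<noteq> s" by blast
    show "?q p \<le> M" unfolding p using M[OF ts(1,2)] ts(3) by (simp add: divide_le_eq)
  qed
  then have up: "?q p \<le> C" if "p \<in> ?A" for p unfolding C by (rule cSUP_upper[OF that])
  have "0 \<le> ?q (a, b)" by simp
  also have "\<dots> \<le> C" using \<open>a < b\<close> by (intro up) auto
  finally show "C \<ge> 0" .
  show "norm (?g t - ?g s) \<le> C * \<bar>t - s\<bar> powr \<beta>" if "s \<in> {a..b}" "t \<in> {a..b}"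
  proof (cases "t = s")
    case False
    then have "?q (t, s) \<le> C" using that by (intro up) auto
    then show ?thesis using False by (simp add: divide_le_eq)
  qed simp
qed

section \<open>The power function as witness for strictness\<close>

lemma DERIV_powr_within_interval:
  fixes q :: real
  assumes "q > 1" "t \<in> {a..b}"
  shows "((\<lambda>t. (t - a) powr q) has_real_derivative q * (t - a) powr (q - 1)) (at t within {a..b})"
proof (cases "t = a")
  case False
  then have "((\<lambda>t. (t - a) powr q) has_real_derivative q * (t - a) powr (q - 1)) (at t)"
    using assms by (auto intro!: derivative_eq_intros)
  then show ?thesis by (rule has_field_derivative_at_within)
next
  case True
  have "((\<lambda>y. (y - a) powr (q - 1)) \<longlongrightarrow> 0) (at a within {a..b})"
    by (rule tendsto_zero_powrI[OF _ tendsto_const])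
      (use assms in \<open>auto intro!: tendsto_eq_intros simp: eventually_at_filter\<close>)
  then have "((\<lambda>y. (y - a) powr q / (y - a)) \<longlongrightarrow> 0) (at a within {a..b})"
    by (rule Lim_transform_eventually) (auto simp: eventually_at_filter powr_diff)
  then show ?thesis using True by (simp add: has_field_derivative_iff)
qed

text \<open>Substitution of \<open>s = a + (t - a) * u\<close>. The number \<open>J\<close> is the
  Beta integral with parameters \<open>q + 1\<close> and \<open>1 - p\<close>; only its independence
  of \<open>a\<close> and \<open>t\<close> is used.\<close>

lemma integral_beta_scaling:
  fixes p q :: real
  assumes "p < 1" "q > 0"
  obtains J where "\<And>a t. a \<le> t \<Longrightarrow>
    ((\<lambda>s. (t - s) powr - p * (s - a) powr q) has_integral (t - a) powr (q - p + 1) * J) {a..t}"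
proof -
  let ?\<phi> = "\<lambda>s. (1 - s) powr - p * s powr q"
  have "continuous_on {0..1::real} (\<lambda>s. s powr q)"
    using assms by (intro continuous_on_powr' continuous_intros) auto
  from banach_integral_closed_interval[OF integrable_powr_reflected[OF assms(1)] this]
  obtain J where J: "(?\<phi> has_integral J) {0..1}" by auto
  have "((\<lambda>s. (t - s) powr - p * (s - a) powr q) has_integral (t - a) powr (q - p + 1) * J) {a..t}"
    if "a \<le> t" for a t
  proof (cases "a = t")
    case False
    with that have pos: "t - a > 0" by simp
    define m where "m = 1 / (t - a)"
    have m: "m > 0" using pos by (simp add: m_def)
    have "((\<lambda>s. ?\<phi> (m *\<^sub>R s + - (a * m))) has_integral J /\<^sub>R m ^ DIM(real))
        (cbox ((0 - - (a * m)) /\<^sub>R m) ((1 - - (a * m)) /\<^sub>R m))"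
      using J m by (intro has_integral_affinity') auto
    moreover have "(0 - - (a * m)) /\<^sub>R m = a" "(1 - - (a * m)) /\<^sub>R m = t"
      using pos by (simp_all add: m_def field_simps)
    ultimately have "((\<lambda>s. ?\<phi> (m * s - a * m)) has_integral (t - a) * J) {a..t}"
      by (simp add: m_def)
    then have "((\<lambda>s. (t - a) powr (q - p) * ?\<phi> (m * s - a * m)) has_integral (t - a) powr (q - p) * ((t - a) * J)) {a..t}"
      by (rule has_integral_mult_right)
    moreover have "(t - a) powr (q - p) * ?\<phi> (m * s - a * m) = (t - s) powr - p * (s - a) powr q"
      if "s \<in> {a..t}" for s
    proof -
      have ms: "m * s - a * m = (s - a) / (t - a)" by (simp add: m_def diff_divide_distrib)
      have one: "1 - (s - a) / (t - a) = (t - s) / (t - a)" using pos by (simp add: field_simps)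
      show ?thesis unfolding ms one using pos that
        by (simp add: powr_divide powr_diff powr_minus field_simps)
    qed
    ultimately have "((\<lambda>s. (t - s) powr - p * (s - a) powr q) has_integral (t - a) powr (q - p) * ((t - a) * J)) {a..t}"
      by (rule has_integral_eq[rotated])
    then show ?thesis using pos by (simp add: powr_add mult_ac)
  qed (simp add: has_integral_refl)
  then show thesis by (rule that)
qed

text \<open>The witness for strictness is \<open>(t - a)\<^bsup>n + \<alpha>\<^esup>\<close>: its Caputo derivative is constant, whereas its
  \<open>n\<close>-th derivative \<open>(t - a)\<^bsup>\<alpha>\<^esup>\<close> fails the Hoelder condition of exponent \<open>\<beta> > \<alpha>\<close> at \<open>a\<close>.\<close>

lemma power_function_strictness:
  fixes x :: "'a::banach"
  assumes "a < b" and \<alpha>: "0 < \<alpha>" "\<alpha> < \<beta>" "\<beta> \<le> 1" and "x \<noteq> 0"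
  shows "(\<lambda>t. (t - a) powr (real n + \<alpha>) *\<^sub>R x) \<in> caputo_space a b (real n + \<alpha>) - holder_space a b n \<beta>"
proof -
  have \<alpha>1: "\<alpha> < 1" using \<alpha> by simp
  define r where "r = real n + \<alpha>"
  \<comment> \<open>The falling factorial of \<open>r\<close> of length \<open>j\<close> is the
    coefficient of the \<open>j\<close>-th derivative of the power.\<close>
  define c where "c j = (\<Prod>i<j. r - real i)" for j
  define F where "F j = (\<lambda>t. (c j * (t - a) powr (r - real j)) *\<^sub>R x)" for j
  have F0: "F 0 = (\<lambda>t. (t - a) powr (real n + \<alpha>) *\<^sub>R x)" by (simp add: F_def c_def r_def)
  have dF: "(F j has_vector_derivative F (Suc j) t) (at t within {a..b})" if "j < n" "t \<in> {a..b}" for j t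
  proof -
    have "r - real j > 1" using that(1) \<alpha>(1) by (simp add: r_def)
    from DERIV_cmult[OF DERIV_powr_within_interval[OF this that(2)], of "c j"]
    have "((\<lambda>t. c j * (t - a) powr (r - real j)) has_real_derivative c (Suc j) * (t - a) powr (r - real (Suc j))) (at t within {a..b})"
      by (simp add: c_def mult_ac diff_diff_eq add.commute)
    from has_vector_derivative_scaleR[OF this has_vector_derivative_const[of x]]
    show ?thesis by (simp add: F_def)
  qed
  have cF: "continuous_on {a..b} (F n)"
    unfolding F_def r_def using \<alpha>(1) by (intro continuous_intros continuous_on_powr') auto
  have eq: "ivl_deriv a b j (F 0) t = F j t" if "j \<le> n" "t \<in> {a..b}" for j t
    by (rule ivl_deriv_eq[where F = F, OF \<open>a < b\<close> dF cF that])
  have Ck: "F 0 \<in> Ck a b n" by (rule mem_Ck[where F = F, OF \<open>a < b\<close> dF cF])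
  \<comment> \<open>The exponents \<open>r - j\<close> are at least \<alpha>, so all these
    derivatives vanish at \<open>a\<close> and the Taylor polynomial is zero.\<close>
  have "ivl_deriv a b j (F 0) a = 0" if "j \<le> n" for j
    using eq[OF that, of a] \<open>a < b\<close> by (simp add: F_def)
  then have rest: "taylor_rest a b n (F 0) 0 = F 0"
    by (intro ext) (simp add: taylor_rest_def del: sum.lessThan_Suc)
  obtain J where J: "\<And>a t. a \<le> t \<Longrightarrow>
    ((\<lambda>s. (t - s) powr - \<alpha> * (s - a) powr r) has_integral (t - a) powr (r - \<alpha> + 1) * J) {a..t}"
    using integral_beta_scaling[OF \<alpha>1, of r] \<alpha>(1) unfolding r_def by auto
  define D where "D = J / Gamma (1 - \<alpha>)"
  \<comment> \<open>The chain starts at \<open>D * (t - a) ^ Suc n\<close> times \<open>x\<close>,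
    the fractional integral of the witness, and ends at the constant \<open>D * fact (Suc n)\<close>
    times \<open>x\<close>.\<close>
  define V where "V j = (\<lambda>t. (D * fact (Suc n) * ((t - a) ^ (Suc n - j) / fact (Suc n - j))) *\<^sub>R x)" for j
  have cF0: "continuous_on {a..b} (F 0)" using Ck by (force simp: Ck_def)
  have rl: "rl_integral a (1 - \<alpha>) (F 0) t = V 0 t" if t: "t \<in> {a..b}" for t
  proof -
    have "integral {a..t} (\<lambda>s. (t - s) powr - \<alpha> *\<^sub>R F 0 s) = integral {a..t} (\<lambda>s. ((t - s) powr - \<alpha> * (s - a) powr r) *\<^sub>R x)"
      by (simp add: F_def c_def)
    also have "\<dots> = ((t - a) powr (r - \<alpha> + 1) * J) *\<^sub>R x"
      using J[of a t] t by (intro integral_unique has_integral_scaleR_left) auto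
    also have "(t - a) powr (r - \<alpha> + 1) = (t - a) ^ Suc n"
    proof (cases "t = a")
      case False
      then have "(t - a) powr real (Suc n) = (t - a) ^ Suc n" using t by (intro powr_realpow) auto
      then show ?thesis by (simp add: r_def add.commute)
    qed simp
    finally show ?thesis unfolding rl_integral_eq[OF \<alpha>1 cF0 t] by (simp add: V_def D_def del: fact_Suc power_Suc)
  qed
  have dV: "(V j has_vector_derivative V (Suc j) t) (at t within {a..b})" if "j < Suc n" for j t
  proof -
    define m where "m = n - j"
    have m: "Suc n - j = Suc m" "Suc n - Suc j = m" using that by (auto simp: m_def)
    have "((\<lambda>t. D * fact (Suc n) * ((t - a) ^ Suc m / fact (Suc m))) has_real_derivative
        D * fact (Suc n) * (real (Suc m) * (t - a) ^ m / fact (Suc m))) (at t within {a..b})"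
      by (auto intro!: derivative_eq_intros simp del: fact_Suc of_nat_Suc power_Suc)
    moreover have "real (Suc m) * (t - a) ^ m / fact (Suc m) = (t - a) ^ m / fact m"
      by (simp add: divide_simps del: of_nat_Suc)
    ultimately have "((\<lambda>t. D * fact (Suc n) * ((t - a) ^ Suc m / fact (Suc m))) has_real_derivative
        D * fact (Suc n) * ((t - a) ^ m / fact m)) (at t within {a..b})" by simp
    from has_vector_derivative_scaleR[OF this has_vector_derivative_const[of x]]
    show ?thesis unfolding V_def m by simp
  qed
  have cV: "continuous_on {a..b} (V (Suc n))" by (simp add: V_def)
  \<comment> \<open>A constant sequence turns the limit theorem into the statement that classical
    derivatives are weak ones.\<close>
  have "uniform_limit {a..b} (\<lambda>i::nat. V 0) (rl_integral a (1 - \<alpha>) (F 0)) sequentially"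
    by (subst uniform_limit_cong'[where g = "\<lambda>_. V 0" and i = "V 0"]) (simp_all add: rl uniform_limit_const)
  then have "has_weak_deriv a b (Suc n) (rl_integral a (1 - \<alpha>) (F 0)) (V (Suc n))"
    using has_weak_deriv_uniform_limit[where V = "\<lambda>_. V", OF \<open>a < b\<close> dV cV _ uniform_limit_const] by blast
  then have "has_caputo_deriv a b (real n + \<alpha>) (F 0) (V (Suc n))"
    unfolding has_caputo_deriv_iff[OF \<alpha>(1) \<alpha>1] rest .
  then have 1: "F 0 \<in> caputo_space a b (real n + \<alpha>)"
    unfolding caputo_space_def nat_ceiling_nat_plus_frac[OF \<alpha>(1) less_imp_le[OF \<alpha>1]] using Ck cV by auto
  have 2: "F 0 \<notin> holder_space a b n \<beta>"
  proof
    assume "F 0 \<in> holder_space a b n \<beta>"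
    then obtain M where M: "M > 0" "\<And>t s. t \<in> {a..b} \<Longrightarrow> s \<in> {a..b} \<Longrightarrow>
        norm (ivl_deriv a b n (F 0) t - ivl_deriv a b n (F 0) s) \<le> M * \<bar>t - s\<bar> powr \<beta>"
      unfolding holder_space_def by blast
    have cn: "c n > 0" unfolding c_def r_def using \<alpha>(1) by (intro prod_pos) auto
    have le: "c n * norm x \<le> M * h powr (\<beta> - \<alpha>)" if h: "0 < h" "h \<le> b - a" for h
    proof -
      have "c n * norm x * h powr \<alpha> = norm (F n (a + h) - F n a)"
        using cn by (simp add: F_def r_def abs_mult)
      also have "\<dots> \<le> M * h powr \<beta>"
        using M(2)[of "a + h" a] eq[of n "a + h"] eq[of n a] h by simp
      also have "\<dots> = M * h powr (\<beta> - \<alpha>) * h powr \<alpha>" by (simp flip: powr_add)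
      finally show ?thesis using h by simp
    qed
    define e where "e = c n * norm x / M"
    have e: "e > 0" using cn M(1) \<open>x \<noteq> 0\<close> by (simp add: e_def)
    \<comment> \<open>The power is chosen so that \<open>M * h powr (\<beta> - \<alpha>)\<close> is
      at most half of the lower bound \<open>c n * norm x\<close>; the minimum keeps
      \<open>a + h\<close> in the interval.\<close>
    define h where "h = min (b - a) ((e / 2) powr (1 / (\<beta> - \<alpha>)))"
    have h: "0 < h" "h \<le> b - a" using \<open>a < b\<close> e by (auto simp: h_def)
    have "h powr (\<beta> - \<alpha>) \<le> ((e / 2) powr (1 / (\<beta> - \<alpha>))) powr (\<beta> - \<alpha>)"
      using h \<alpha> by (intro powr_mono2) (auto simp: h_def)
    also have "\<dots> = e / 2" using e \<alpha> by (simp add: powr_powr)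
    finally have "M * h powr (\<beta> - \<alpha>) \<le> M * (e / 2)" using M(1) by simp
    also have "\<dots> < M * e" using M(1) e by simp
    also have "\<dots> = c n * norm x" using M(1) by (simp add: e_def)
    finally show False using le[OF h] by simp
  qed
  from 1 2 show ?thesis unfolding F0 by blast
qed

section \<open>Inclusion, strictness and continuity of the embedding\<close>

theorem corollary20:
  fixes t0 t1 \<alpha> \<beta> :: real and n :: nat
  assumes "(UNIV :: 'a::banach set) \<noteq> {0}"
    and "t0 < t1"
    and "0 < \<alpha>" and "\<alpha> < \<beta>" and "\<beta> \<le> 1"
  shows "(holder_space t0 t1 n \<beta> :: (real \<Rightarrow> 'a) set) \<subset> caputo_space t0 t1 (real n + \<alpha>) \<and>
         (\<exists>M>0. \<forall>f \<in> (holder_space t0 t1 n \<beta> :: (real \<Rightarrow> 'a) set).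
            caputo_norm t0 t1 (real n + \<alpha>) f \<le> M * holder_norm t0 t1 n \<beta> f)"
proof (intro conjI)
  have \<alpha>1: "\<alpha> < 1" using assms by simp
  note ceil = nat_ceiling_nat_plus_frac[OF \<open>0 < \<alpha>\<close> less_imp_le[OF \<alpha>1]]
  define K where "K = (1 + 3 / (\<beta> - \<alpha>)) * (t1 - t0) powr (\<beta> - \<alpha>) / Gamma (1 - \<alpha>)"
  have key: "\<exists>w. continuous_on {t0..t1} w \<and> has_caputo_deriv t0 t1 (real n + \<alpha>) f w \<and>
      (\<forall>t\<in>{t0..t1}. norm (w t) \<le> (holder_norm t0 t1 n \<beta> f - Ck_norm t0 t1 n f) * K)"
    if f: "f \<in> holder_space t0 t1 n \<beta>" for f :: "real \<Rightarrow> 'a"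
  proof -
    have "f \<in> Ck t0 t1 n" using f by (simp add: holder_space_def)
    then obtain w where "continuous_on {t0..t1} w" "has_caputo_deriv t0 t1 (real n + \<alpha>) f w"
      "\<And>t. t \<in> {t0..t1} \<Longrightarrow> norm (w t) \<le> (holder_norm t0 t1 n \<beta> f - Ck_norm t0 t1 n f) * K"
      using holder_imp_has_caputo_deriv[OF assms(2-5) _ holder_seminorm_bound[OF assms(2) f]]
      unfolding K_def by blast
    then show ?thesis by blast
  qed
  have "holder_space t0 t1 n \<beta> \<subseteq> (caputo_space t0 t1 (real n + \<alpha>) :: (real \<Rightarrow> 'a) set)"
  proof
    fix f :: "real \<Rightarrow> 'a" assume f: "f \<in> holder_space t0 t1 n \<beta>"
    then have "f \<in> Ck t0 t1 n" by (simp add: holder_space_def)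
    then show "f \<in> caputo_space t0 t1 (real n + \<alpha>)"
      using key[OF f] unfolding caputo_space_def ceil by auto
  qed
  moreover obtain x :: 'a where "x \<noteq> 0" using assms(1) by blast
  ultimately show "holder_space t0 t1 n \<beta> \<subset> (caputo_space t0 t1 (real n + \<alpha>) :: (real \<Rightarrow> 'a) set)"
    using power_function_strictness[OF assms(2-5), of x n] by blast
  show "\<exists>M>0. \<forall>f \<in> (holder_space t0 t1 n \<beta> :: (real \<Rightarrow> 'a) set).
      caputo_norm t0 t1 (real n + \<alpha>) f \<le> M * holder_norm t0 t1 n \<beta> f"
  proof (intro exI conjI ballI)
    \<comment> \<open>Both norms contain the same norm of order \<open>n\<close>, which needs the
      factor 1; the Hoelder seminorm \<open>C\<close> controls the Caputo derivative with factor
      \<open>K\<close>.\<close>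
    show "max 1 K > 0" by simp
    fix f :: "real \<Rightarrow> 'a" assume f: "f \<in> holder_space t0 t1 n \<beta>"
    let ?N = "Ck_norm t0 t1 n f"
    define C where "C = holder_norm t0 t1 n \<beta> f - ?N"
    have C: "C \<ge> 0" unfolding C_def by (rule holder_seminorm_bound(1)[OF assms(2) f])
    have N: "?N \<ge> 0" using f assms(2) by (intro Ck_norm_nonneg) (auto simp: holder_space_def)
    obtain w where w: "continuous_on {t0..t1} w" "has_caputo_deriv t0 t1 (real n + \<alpha>) f w"
      "\<And>t. t \<in> {t0..t1} \<Longrightarrow> norm (w t) \<le> C * K"
      using key[OF f] unfolding C_def by blast
    have "sup_norm t0 t1 (caputo_deriv t0 t1 (real n + \<alpha>) f) \<le> C * K"
      unfolding sup_norm_def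
    proof (rule cSUP_least)
      show "{t0..t1} \<noteq> {}" using assms(2) by simp
      fix t assume t: "t \<in> {t0..t1}"
      show "norm (caputo_deriv t0 t1 (real n + \<alpha>) f t) \<le> C * K"
        unfolding caputo_deriv_eq[OF assms(2) w(1,2) t] by (rule w(3)[OF t])
    qed
    then have "caputo_norm t0 t1 (real n + \<alpha>) f \<le> 1 * ?N + K * C"
      unfolding caputo_norm_def ceil by (simp add: mult.commute)
    also have "\<dots> \<le> max 1 K * ?N + max 1 K * C"
      using C N by (intro add_mono mult_right_mono) auto
    also have "\<dots> = max 1 K * holder_norm t0 t1 n \<beta> f" by (simp add: C_def algebra_simps)
    finally show "caputo_norm t0 t1 (real n + \<alpha>) f \<le> max 1 K * holder_norm t0 t1 n \<beta> f" .
  qed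
qed

end
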